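(* Let $\mathfrak s$ be any solvable Lie algebra over $\mathbb K$ and let $\mathfrak s''$ be the second term of its derived series, i.e. $\mathfrak s'=[\mathfrak s,\mathfrak s]$ and $\mathfrak s''=[\mathfrak s',\mathfrak s']$. Then $$\Gamma_\circ^1(\mathfrak s)\subset\chi(\mathfrak s,\mathfrak s/\mathfrak s'').$$
   Context: $\mathbb K$ is an algebraically closed field of characteristic $0$; all Lie algebras and modules are finite dimensional over $\mathbb K$. $\Gamma_\circ^1(\mathfrak s)$ is the set of (equivalence classes of) irreducible finite dimensional $\mathfrak s$-modules $V$ with $H^1(\mathfrak s,V)\ne0$ (Lie algebra cohomology). For an $\mathfrak s$-module $W$, $\chi(\mathfrak s,W)$ is the set of (classes of) irreducible quotients occurring in a composition series of $W$. Since $\mathfrak s$ is solvable, irreducible modules are one dimensional, so both sets are identified with sets of characters of $\mathfrak s$ (elements of $(\mathfrak s/\mathfrak s')^*$). $\mathfrak s/\mathfrak s''$ is an $\mathfrak s$-module via the adjoint action. Here $\subset$ means inclusion, not necessarily proper. *)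

theory Defs
  imports "HOL-Algebra.AbelCoset" "Jordan_Normal_Form.VS_Connect"
begin

section \<open>Lie algebras and modules\<close>

text \<open>
  Vector spaces over the field \<open>'k\<close> are \<^typ>\<open>('k, 'a) module\<close> records satisfying
  \<^term>\<open>vectorspace class_ring\<close>.  These records extend \<^typ>\<open>'a ring\<close>, but
  their fields \<open>mult\<close> and \<open>one\<close> play no role here.
\<close>

record ('k, 'g) lie_algebra = "('k, 'g) module" +
  bracket :: "'g \<Rightarrow> 'g \<Rightarrow> 'g"

record ('k, 'g, 'v) lie_module = "('k, 'v) module" +
  act :: "'g \<Rightarrow> 'v \<Rightarrow> 'v"

locale lie_algebra = vectorspace "class_ring :: 'k ring" L
  for L :: "('k::field, 'g) lie_algebra" +
  assumes bracket_closed: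
      "\<lbrakk>x \<in> carrier L; y \<in> carrier L\<rbrakk> \<Longrightarrow> bracket L x y \<in> carrier L"
    and bracket_add_left:
      "\<lbrakk>x \<in> carrier L; y \<in> carrier L; z \<in> carrier L\<rbrakk> \<Longrightarrow>
        bracket L (x \<oplus>\<^bsub>L\<^esub> y) z = bracket L x z \<oplus>\<^bsub>L\<^esub> bracket L y z"
    and bracket_add_right:
      "\<lbrakk>x \<in> carrier L; y \<in> carrier L; z \<in> carrier L\<rbrakk> \<Longrightarrow>
        bracket L x (y \<oplus>\<^bsub>L\<^esub> z) = bracket L x y \<oplus>\<^bsub>L\<^esub> bracket L x z"
    and bracket_smult_left:
      "\<lbrakk>x \<in> carrier L; y \<in> carrier L\<rbrakk> \<Longrightarrow>
        bracket L (c \<odot>\<^bsub>L\<^esub> x) y = c \<odot>\<^bsub>L\<^esub> bracket L x y"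
    and bracket_smult_right:
      "\<lbrakk>x \<in> carrier L; y \<in> carrier L\<rbrakk> \<Longrightarrow>
        bracket L x (c \<odot>\<^bsub>L\<^esub> y) = c \<odot>\<^bsub>L\<^esub> bracket L x y"
    and bracket_self:
      "x \<in> carrier L \<Longrightarrow> bracket L x x = \<zero>\<^bsub>L\<^esub>"
    and jacobi:
      "\<lbrakk>x \<in> carrier L; y \<in> carrier L; z \<in> carrier L\<rbrakk> \<Longrightarrow>
        bracket L x (bracket L y z) \<oplus>\<^bsub>L\<^esub> bracket L y (bracket L z x)
          \<oplus>\<^bsub>L\<^esub> bracket L z (bracket L x y) = \<zero>\<^bsub>L\<^esub>"

locale lie_module = L: lie_algebra L + M: vectorspace "class_ring :: 'k ring" M
  for L :: "('k::field, 'g) lie_algebra" and M :: "('k, 'g, 'v) lie_module" +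
  assumes act_closed:
      "\<lbrakk>x \<in> carrier L; v \<in> carrier M\<rbrakk> \<Longrightarrow> act M x v \<in> carrier M"
    and act_add_left:
      "\<lbrakk>x \<in> carrier L; y \<in> carrier L; v \<in> carrier M\<rbrakk> \<Longrightarrow>
        act M (x \<oplus>\<^bsub>L\<^esub> y) v = act M x v \<oplus>\<^bsub>M\<^esub> act M y v"
    and act_smult_left:
      "\<lbrakk>x \<in> carrier L; v \<in> carrier M\<rbrakk> \<Longrightarrow>
        act M (c \<odot>\<^bsub>L\<^esub> x) v = c \<odot>\<^bsub>M\<^esub> act M x v"
    and act_add_right:
      "\<lbrakk>x \<in> carrier L; v \<in> carrier M; w \<in> carrier M\<rbrakk> \<Longrightarrow>
        act M x (v \<oplus>\<^bsub>M\<^esub> w) = act M x v \<oplus>\<^bsub>M\<^esub> act M x w"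
    and act_smult_right:
      "\<lbrakk>x \<in> carrier L; v \<in> carrier M\<rbrakk> \<Longrightarrow>
        act M x (c \<odot>\<^bsub>M\<^esub> v) = c \<odot>\<^bsub>M\<^esub> act M x v"
    and act_bracket:
      "\<lbrakk>x \<in> carrier L; y \<in> carrier L; v \<in> carrier M\<rbrakk> \<Longrightarrow>
        act M (bracket L x y) v = act M x (act M y v) \<ominus>\<^bsub>M\<^esub> act M y (act M x v)"

definition adjoint_module :: "('k, 'g) lie_algebra \<Rightarrow> ('k, 'g, 'g) lie_module" where
  "adjoint_module L =
    module.extend (module.truncate L) (lie_module.fields (bracket L))"


section \<open>Solvability\<close>

primrec derived_series :: "('k::field, 'g) lie_algebra \<Rightarrow> nat \<Rightarrow> 'g set" where
  "derived_series L 0 = carrier L"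
| "derived_series L (Suc n) =
    LinearCombinations.module.span class_ring L
      {bracket L x y | x y. x \<in> derived_series L n \<and> y \<in> derived_series L n}"

definition solvable_lie_algebra :: "('k::field, 'g) lie_algebra \<Rightarrow> bool" where
  "solvable_lie_algebra L \<longleftrightarrow> lie_algebra L \<and> (\<exists>n. derived_series L n = {\<zero>\<^bsub>L\<^esub>})"


section \<open>Quotients\<close>

text \<open>The elements of a quotient are cosets.  As for \<open>rcoset_mult\<close> in the construction of
  quotient rings, an operation on the coset \<open>X\<close> is the union of the cosets that it yields on the
  representatives \<open>v \<in> X\<close>; these all coincide when \<open>N\<close> is stable under the operation.\<close>

definition quotient_space ::
    "('k, 'v, 'm) module_scheme \<Rightarrow> 'v set \<Rightarrow> ('k, 'v set) module" where
  "quotient_space M N =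
    \<lparr>carrier = a_rcosets\<^bsub>M\<^esub> N, mult = undefined, one = undefined,
     zero = N, add = set_add M,
     smult = (\<lambda>c X. \<Union>v\<in>X. N +>\<^bsub>M\<^esub> (c \<odot>\<^bsub>M\<^esub> v))\<rparr>"

definition quotient_module ::
    "('k, 'g, 'v) lie_module \<Rightarrow> 'v set \<Rightarrow> ('k, 'g, 'v set) lie_module" where
  "quotient_module M N =
    module.extend (quotient_space M N)
      (lie_module.fields (\<lambda>x X. \<Union>v\<in>X. N +>\<^bsub>M\<^esub> (act M x v)))"


section \<open>Irreducible modules and composition factors\<close>

definition lie_submodule ::
    "('k::field, 'g) lie_algebra \<Rightarrow> 'v set \<Rightarrow> ('k, 'g, 'v) lie_module \<Rightarrow> bool" where
  "lie_submodule L N M \<longleftrightarrow>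
    lie_module L M \<and> LinearCombinations.submodule class_ring N M \<and>
    (\<forall>x\<in>carrier L. \<forall>v\<in>N. act M x v \<in> N)"

definition irreducible_lie_module ::
    "('k::field, 'g) lie_algebra \<Rightarrow> ('k, 'g, 'v) lie_module \<Rightarrow> bool" where
  "irreducible_lie_module L M \<longleftrightarrow>
    lie_module L M \<and> carrier M \<noteq> {\<zero>\<^bsub>M\<^esub>} \<and>
    (\<forall>N. lie_submodule L N M \<longrightarrow> N = {\<zero>\<^bsub>M\<^esub>} \<or> N = carrier M)"

definition lie_module_isomorphic ::
    "('k::field, 'g) lie_algebra \<Rightarrow> ('k, 'g, 'v) lie_module \<Rightarrow> ('k, 'g, 'w) lie_module \<Rightarrow> bool"
  where
  "lie_module_isomorphic L M M' \<longleftrightarrow>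
    lie_module L M \<and> lie_module L M' \<and>
    (\<exists>f \<in> LinearCombinations.module_hom class_ring M M'. bij_betw f (carrier M) (carrier M') \<and>
      (\<forall>x\<in>carrier L. \<forall>v\<in>carrier M. f (act M x v) = act M' x (f v)))"

definition series_factor ::
    "('k, 'g, 'v) lie_module \<Rightarrow> 'v set list \<Rightarrow> nat \<Rightarrow> ('k, 'g, 'v set) lie_module" where
  "series_factor W Ns i = quotient_module (W\<lparr>carrier := Ns ! Suc i\<rparr>) (Ns ! i)"

definition composition_series ::
    "('k::field, 'g) lie_algebra \<Rightarrow> ('k, 'g, 'v) lie_module \<Rightarrow> 'v set list \<Rightarrow> bool" where
  "composition_series L W Ns \<longleftrightarrow>
    lie_module L W \<and> Ns \<noteq> [] \<and> hd Ns = {\<zero>\<^bsub>W\<^esub>} \<and> last Ns = carrier W \<and>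
    (\<forall>N\<in>set Ns. lie_submodule L N W) \<and>
    (\<forall>i. Suc i < length Ns \<longrightarrow>
      Ns ! i \<subseteq> Ns ! Suc i \<and> irreducible_lie_module L (series_factor W Ns i))"

text \<open>A set of isomorphism classes of modules is represented by the isomorphism-closed set of the
  modules with underlying type \<open>'v\<close> that lie in these classes, where \<open>'v\<close> is arbitrary.\<close>

definition composition_factors ::
    "('k::field, 'g) lie_algebra \<Rightarrow> ('k, 'g, 'w) lie_module \<Rightarrow> ('k, 'g, 'v) lie_module set" where
  "composition_factors L W =
    {V. \<exists>Ns i. composition_series L W Ns \<and> Suc i < length Ns \<and>
      lie_module_isomorphic L V (series_factor W Ns i)}"


section \<open>First cohomology\<close>

text \<open>The Chevalley-Eilenberg complex in degrees 0, 1, 2.  Cochains of degree 1 are the linear maps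
  \<open>L \<rightarrow> V\<close>, made \<open>undefined\<close> off the carrier of \<open>L\<close> so that each is given by a unique function.\<close>

definition cochains1 ::
    "('k::field, 'g) lie_algebra \<Rightarrow> ('k, 'g, 'v) lie_module \<Rightarrow> ('k, 'g \<Rightarrow> 'v) module" where
  "cochains1 L V =
    \<lparr>carrier = LinearCombinations.module_hom class_ring L V \<inter> extensional (carrier L),
     mult = undefined, one = undefined,
     zero = (\<lambda>x\<in>carrier L. \<zero>\<^bsub>V\<^esub>),
     add = (\<lambda>f g. \<lambda>x\<in>carrier L. f x \<oplus>\<^bsub>V\<^esub> g x),
     smult = (\<lambda>c f. \<lambda>x\<in>carrier L. c \<odot>\<^bsub>V\<^esub> f x)\<rparr>"

definition differential0 ::
    "('k, 'g) lie_algebra \<Rightarrow> ('k, 'g, 'v) lie_module \<Rightarrow> 'v \<Rightarrow> 'g \<Rightarrow> 'v" where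
  "differential0 L V v = (\<lambda>x\<in>carrier L. act V x v)"

definition differential1 ::
    "('k, 'g) lie_algebra \<Rightarrow> ('k, 'g, 'v) lie_module \<Rightarrow> ('g \<Rightarrow> 'v) \<Rightarrow> 'g \<Rightarrow> 'g \<Rightarrow> 'v" where
  "differential1 L V f x y =
    (act V x (f y) \<ominus>\<^bsub>V\<^esub> act V y (f x)) \<ominus>\<^bsub>V\<^esub> f (bracket L x y)"

definition cocycles1 ::
    "('k::field, 'g) lie_algebra \<Rightarrow> ('k, 'g, 'v) lie_module \<Rightarrow> ('g \<Rightarrow> 'v) set" where
  "cocycles1 L V =
    {f \<in> carrier (cochains1 L V).
      \<forall>x\<in>carrier L. \<forall>y\<in>carrier L. differential1 L V f x y = \<zero>\<^bsub>V\<^esub>}"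

definition coboundaries1 ::
    "('k, 'g) lie_algebra \<Rightarrow> ('k, 'g, 'v) lie_module \<Rightarrow> ('g \<Rightarrow> 'v) set" where
  "coboundaries1 L V = differential0 L V ` carrier V"

definition cohomology1 ::
    "('k::field, 'g) lie_algebra \<Rightarrow> ('k, 'g, 'v) lie_module \<Rightarrow> ('k, ('g \<Rightarrow> 'v) set) module" where
  "cohomology1 L V =
    quotient_space ((cochains1 L V)\<lparr>carrier := cocycles1 L V\<rparr>) (coboundaries1 L V)"

definition Gamma1 ::
    "('k::field, 'g) lie_algebra \<Rightarrow> ('k, 'g, 'v) lie_module set" where
  "Gamma1 L =
    {V. irreducible_lie_module L V \<and> vectorspace.fin_dim class_ring V \<and>
      carrier (cohomology1 L V) \<noteq> {\<zero>\<^bsub>cohomology1 L V\<^esub>}}"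

end

theory Submission
  imports Defs
begin

text \<open>
Let \<open>V\<close> be an irreducible finite dimensional \<open>\<ss>\<close>-module with a cocycle \<open>z : \<ss> \<rightarrow> V\<close> that is
not a coboundary.  The point is that \<open>V\<close> is already the image of an equivariant map from a submodule
of \<open>\<ss>/\<ss>''\<close>, and that this map is induced by \<open>z\<close> itself.

By Lie's theorem (\<open>derived_algebra_annihilates_irreducible\<close>) the ideal \<open>\<ss>'\<close> acts on \<open>V\<close> as zero.
The cocycle identity \<open>z [x, y] = x z(y) - y z(x)\<close> then says that \<open>z\<close> vanishes on \<open>\<ss>''\<close> and that its
restriction to \<open>\<ss>'\<close> is equivariant.  If this restriction is not zero, it maps \<open>\<ss>'/\<ss>''\<close> onto \<open>V\<close>.
Otherwise \<open>\<ss>\<close> has to act trivially: if some \<open>x\<close> acts as a nonzero operator, this operator commutes with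
the action of \<open>\<ss>\<close> and is therefore invertible, and \<open>0 = z [x, y] = x z(y) - y z(x)\<close> exhibits \<open>z\<close> as
the coboundary of \<open>x\<inverse> z(x)\<close> (\<open>cocycle_zero_on_derived_is_coboundary\<close>).  For the trivial action,
\<open>z\<close> is a nonzero equivariant map on all of \<open>\<ss>\<close>.  In both cases \<open>V\<close> is an irreducible subquotient of
\<open>\<ss>/\<ss>''\<close>, and a chain through this subquotient can be refined to a composition series
(\<open>irreducible_subquotient_is_composition_factor\<close>).

The fact that \<open>\<ss>'\<close> acts as zero is obtained by induction along the derived series, starting at its
zero term: if \<open>\<ss>\<^sup>(\<^sup>n\<^sup>+\<^sup>2\<^sup>)\<close> acts as zero, then \<open>\<ss>\<^sup>(\<^sup>n\<^sup>+\<^sup>1\<^sup>)\<close> acts by commuting operators.  The tool is a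
lemma on operators in characteristic 0 (\<open>commutator_singular\<close>), a variant of Jacobson's lemma:
if \<open>W = [N, Y]\<close> commutes with \<open>N\<close> and \<open>N\<close> is singular, then \<open>W\<close> is singular.  It shows first that
\<open>\<ss>\<^sup>(\<^sup>n\<^sup>+\<^sup>1\<^sup>)\<close> acts by scalars (\<open>commuting_ideal_acts_by_scalars\<close>) and then that these scalars are 0.  It
replaces the trace argument of the usual proof of Lie's theorem.
\<close>

section \<open>Subspaces and operators of a vector space\<close>

text \<open>
Vector spaces over a field that is given as a type.  The laws of scalar multiplication are restated
with the operations of the type instead of those of the ring \<open>class_ring\<close>, so that the simplifier can
combine scalars.
\<close>

locale kspace = vectorspace "class_ring :: 'k ring" V
  for V :: "('k::field, 'v, 'm) module_scheme" (structure)
begin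

lemma smult_in [simp]: "v \<in> carrier V \<Longrightarrow> c \<odot> v \<in> carrier V"
  by (rule smult_closed) auto

lemma smult_add_left: "v \<in> carrier V \<Longrightarrow> (a + b) \<odot> v = a \<odot> v \<oplus> b \<odot> v"
  using smult_l_distr[of a b v] by simp

lemma smult_add_right:
  "\<lbrakk>v \<in> carrier V; w \<in> carrier V\<rbrakk> \<Longrightarrow> a \<odot> (v \<oplus> w) = a \<odot> v \<oplus> a \<odot> w"
  using smult_r_distr[of a v w] by simp

lemma smult_smult: "v \<in> carrier V \<Longrightarrow> a \<odot> (b \<odot> v) = (a * b) \<odot> v"
  using smult_assoc1[of a b v] by simp

lemma one_smult [simp]: "v \<in> carrier V \<Longrightarrow> 1 \<odot> v = v"
  using smult_one[of v] by simp

lemma zero_smult [simp]: "v \<in> carrier V \<Longrightarrow> 0 \<odot> v = \<zero>"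
  using smult_l_null[of v] by simp

lemma smult_zero [simp]: "c \<odot> \<zero> = \<zero>"
  using smult_r_null[of c] by simp

lemma neg_smult: "v \<in> carrier V \<Longrightarrow> (- c) \<odot> v = \<ominus> (c \<odot> v)"
  using smult_l_minus[of c v] by (simp add: class_ring_simps)

lemma smult_neg: "v \<in> carrier V \<Longrightarrow> c \<odot> (\<ominus> v) = \<ominus> (c \<odot> v)"
  using smult_r_minus[of c v] by (simp add: class_ring_simps)

lemma smult_eq_zero:
  assumes "v \<in> carrier V" "c \<odot> v = \<zero>" "c \<noteq> 0"
  shows "v = \<zero>"
proof -
  have "v = inverse c \<odot> (c \<odot> v)" using assms(1,3) by (simp add: smult_smult)
  with assms show ?thesis by simp
qed

lemma add_eq_zero_iff:
  "\<lbrakk>v \<in> carrier V; w \<in> carrier V\<rbrakk> \<Longrightarrow> v \<oplus> w = \<zero> \<longleftrightarrow> w = \<ominus> v"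
  by (metis M.minus_equality M.a_comm M.r_neg)

lemma submoduleI:
  assumes "P \<subseteq> carrier V" "\<zero> \<in> P" "\<And>v w. \<lbrakk>v \<in> P; w \<in> P\<rbrakk> \<Longrightarrow> v \<oplus> w \<in> P"
    "\<And>c v. v \<in> P \<Longrightarrow> c \<odot> v \<in> P"
  shows "submodule class_ring P V"
  using assms by (intro submodule.intro module_axioms) auto

lemma submodule_neg:
  assumes "submodule class_ring P V" "v \<in> P"
  shows "\<ominus> v \<in> P"
proof -
  have "v \<in> carrier V" using assms submodule.subset by blast
  then have "\<ominus> v = (- 1) \<odot> v" by (simp add: neg_smult)
  then show ?thesis using submodule.smult_closed[OF assms(1) _ assms(2), of "- 1"] by simp
qed

abbreviation linop :: "('v \<Rightarrow> 'v) \<Rightarrow> bool" where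
  "linop T \<equiv> T \<in> LinearCombinations.module_hom class_ring V V"

lemma linopI:
  assumes "\<And>v. v \<in> carrier V \<Longrightarrow> T v \<in> carrier V"
    "\<And>v w. \<lbrakk>v \<in> carrier V; w \<in> carrier V\<rbrakk> \<Longrightarrow> T (v \<oplus> w) = T v \<oplus> T w"
    "\<And>c v. v \<in> carrier V \<Longrightarrow> T (c \<odot> v) = c \<odot> T v"
  shows "linop T"
  using assms by (auto simp: LinearCombinations.module_hom_def)

lemma linop_in: "\<lbrakk>linop T; v \<in> carrier V\<rbrakk> \<Longrightarrow> T v \<in> carrier V"
  by (auto simp: LinearCombinations.module_hom_def)

lemma linop_add:
  "\<lbrakk>linop T; v \<in> carrier V; w \<in> carrier V\<rbrakk> \<Longrightarrow> T (v \<oplus> w) = T v \<oplus> T w"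
  by (auto simp: LinearCombinations.module_hom_def)

lemma linop_smult: "\<lbrakk>linop T; v \<in> carrier V\<rbrakk> \<Longrightarrow> T (c \<odot> v) = c \<odot> T v"
  by (auto simp: LinearCombinations.module_hom_def)

lemma linop_zero: "linop T \<Longrightarrow> T \<zero> = \<zero>"
  by (metis linop_in linop_smult zero_smult M.zero_closed)

lemma linop_minus:
  assumes "linop T" "v \<in> carrier V" "w \<in> carrier V"
  shows "T (v \<ominus> w) = T v \<ominus> T w"
proof -
  have *: "v \<ominus> w = v \<oplus> (- 1) \<odot> w" if "v \<in> carrier V" "w \<in> carrier V" for v w
    using that by (simp add: neg_smult M.minus_eq)
  show ?thesis
    using assms(2,3) linop_in[OF assms(1)]
    by (simp only: * linop_add[OF assms(1)] linop_smult[OF assms(1)] smult_in)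
qed

lemma minus_zero_right [simp]: "v \<in> carrier V \<Longrightarrow> v \<ominus> \<zero> = v"
  using M.add.inv_one by (simp add: M.minus_eq a_inv_def)

lemma minus_eq_zero_iff:
  assumes "v \<in> carrier V" "w \<in> carrier V"
  shows "v \<ominus> w = \<zero> \<longleftrightarrow> v = w"
proof
  assume "v \<ominus> w = \<zero>"
  then have "\<ominus> w = \<ominus> v"
    using assms add_eq_zero_iff[of v "\<ominus> w"] by (simp add: M.minus_eq)
  then show "v = w" using assms M.minus_minus by metis
qed (use assms in \<open>simp add: M.minus_eq M.r_neg\<close>)

lemma linop_funpow: "linop T \<Longrightarrow> linop (T ^^ n)"
proof (induction n)
  case 0
  then show ?case by (intro linopI) auto
next
  case (Suc n)
  then show ?case by (intro linopI) (auto simp: linop_in linop_add linop_smult)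
qed

lemma linop_shift: "linop T \<Longrightarrow> linop (\<lambda>v. T v \<oplus> c \<odot> v)"
  by (intro linopI)
    (auto simp: linop_in linop_add linop_smult smult_add_right smult_smult mult.commute
      M.a_ac)

lemma kernel_submodule:
  assumes "linop T"
  shows "submodule class_ring {v \<in> carrier V. T v = \<zero>} V"
  using assms by (intro submoduleI) (auto simp: linop_add linop_smult linop_zero)

text \<open>
All that is needed of dimension theory is a strictly monotone bounded measure on subspaces.  Taking the
largest number of linearly independent vectors inside a subspace keeps all spans and independence
relations in the ambient space \<open>V\<close>.
\<close>

lemma subspace_measure:
  assumes "fin_dim"
  obtains \<mu> :: "'v set \<Rightarrow> nat" and b where
    "\<And>P Q. \<lbrakk>submodule class_ring P V; submodule class_ring Q V; P \<subset> Q\<rbrakk> \<Longrightarrow> \<mu> P < \<mu> Q"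
    "\<And>P. submodule class_ring P V \<Longrightarrow> \<mu> P \<le> b"
proof
  let ?C = "\<lambda>P. {card A | A. A \<subseteq> P \<and> lin_indpt A}"
  let ?m = "\<lambda>P. Max (?C P)"
  have bound: "?C P \<subseteq> {..dim}" if "submodule class_ring P V" for P
    using li_le_dim(2)[OF assms] submodule.subset[OF that] by blast
  have ne: "?C P \<noteq> {}" for P
    by (auto simp: lin_dep_def intro: exI[of _ "{}"])
  have fin: "finite (?C P)" if "submodule class_ring P V" for P
    using finite_subset[OF bound[OF that]] by simp
  show "?m P \<le> dim" if "submodule class_ring P V" for P
    using Max_in[OF fin[OF that] ne] bound[OF that] by blast
  show "?m P < ?m Q" if PQ: "submodule class_ring P V" "submodule class_ring Q V" "P \<subset> Q"
    for P Q
  proof -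
    obtain A where A: "A \<subseteq> P" "lin_indpt A" "?m P = card A"
      using Max_in[OF fin[OF PQ(1)] ne] by blast
    obtain v where v: "v \<in> Q" "v \<notin> P" using PQ(3) by blast
    have AV: "A \<subseteq> carrier V" and vV: "v \<in> carrier V"
      using A(1) v(1) submodule.subset[OF PQ(1)] submodule.subset[OF PQ(2)] by blast+
    have "v \<notin> span A" using span_is_subset[OF A(1) PQ(1)] v(2) by blast
    moreover have "v \<notin> A" using A(1) v(2) by blast
    ultimately have "lin_indpt (A \<union> {v})"
      using lin_dep_iff_in_span[OF AV A(2) vV] by blast
    then have "card (A \<union> {v}) \<in> ?C Q" using A(1) PQ(3) v(1) by blast
    then have "card (A \<union> {v}) \<le> ?m Q" using Max_ge[OF fin[OF PQ(2)]] by blast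
    moreover have "finite A" using fin_dim_li_fin[OF assms A(2) AV] .
    ultimately show ?thesis using A(3) \<open>v \<notin> A\<close> by simp
  qed
qed

lemma ascending_chain_stabilises:
  assumes "fin_dim" "\<And>k. submodule class_ring (F k) V" "\<And>k. F k \<subseteq> F (Suc k)"
  shows "\<exists>k. F k = F (Suc k)"
proof (rule ccontr)
  assume *: "\<nexists>k. F k = F (Suc k)"
  obtain \<mu> :: "'v set \<Rightarrow> nat" and b where
    \<mu>: "\<And>P Q. \<lbrakk>submodule class_ring P V; submodule class_ring Q V; P \<subset> Q\<rbrakk> \<Longrightarrow> \<mu> P < \<mu> Q"
    "\<And>P. submodule class_ring P V \<Longrightarrow> \<mu> P \<le> b"
    using subspace_measure[OF assms(1)] by metis
  have "k \<le> \<mu> (F k)" for k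
  proof (induction k)
    case (Suc k)
    have "F k \<subset> F (Suc k)" using assms(3)[of k] * by blast
    then have "\<mu> (F k) < \<mu> (F (Suc k))" by (rule \<mu>(1)[OF assms(2) assms(2)])
    with Suc show ?case by simp
  qed simp
  from this[of "Suc b"] \<mu>(2)[OF assms(2), of "Suc b"] show False by simp
qed

lemma minimal_subspace:
  assumes "fin_dim" "\<And>P. \<Phi> P \<Longrightarrow> submodule class_ring P V" "\<Phi> P0"
  obtains P where "\<Phi> P" "\<And>Q. \<lbrakk>\<Phi> Q; Q \<subseteq> P\<rbrakk> \<Longrightarrow> Q = P"
proof -
  obtain \<mu> :: "'v set \<Rightarrow> nat" and b where
    \<mu>: "\<And>P Q. \<lbrakk>submodule class_ring P V; submodule class_ring Q V; P \<subset> Q\<rbrakk> \<Longrightarrow> \<mu> P < \<mu> Q"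
    using subspace_measure[OF assms(1)] by metis
  obtain P where P: "\<Phi> P" "\<And>Q. \<Phi> Q \<Longrightarrow> \<mu> P \<le> \<mu> Q"
    using ex_has_least_nat[of \<Phi> P0 \<mu>] assms(3) by blast
  show ?thesis
  proof
    show "Q = P" if "\<Phi> Q" "Q \<subseteq> P" for Q
      using P(2)[OF that(1)] \<mu>[OF assms(2)[OF that(1)] assms(2)[OF P(1)]] that(2) by force
  qed fact
qed

section \<open>Eigenvectors\<close>

definition peval :: "('v \<Rightarrow> 'v) \<Rightarrow> 'k poly \<Rightarrow> 'v \<Rightarrow> 'v" where
  "peval T p v = fold_coeffs (\<lambda>a w. a \<odot> v \<oplus> T w) p \<zero>"

lemma peval_0 [simp]: "peval T 0 v = \<zero>"
  by (simp add: peval_def)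

lemma peval_pCons [simp]:
  assumes "linop T" "v \<in> carrier V"
  shows "peval T (pCons a p) v = a \<odot> v \<oplus> T (peval T p v)"
proof (cases "p = 0 \<and> a = 0")
  case True
  then show ?thesis using assms by (simp add: linop_zero)
next
  case False
  then have "fold_coeffs f (pCons a p) = f a \<circ> fold_coeffs f p"
    for f :: "'k \<Rightarrow> 'v \<Rightarrow> 'v"
    by (cases "p = 0") auto
  then show ?thesis by (simp add: peval_def)
qed

context
  fixes T :: "'v \<Rightarrow> 'v" and v :: "'v"
  assumes T: "linop T" and v: "v \<in> carrier V"
begin

lemma peval_in [simp]: "peval T p v \<in> carrier V"
  using T v by (induction p) (auto simp: linop_in)

lemma peval_add: "peval T (p + q) v = peval T p v \<oplus> peval T q v"
  using T v
  by (induction p q rule: poly_induct2)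
    (simp_all add: linop_in linop_add smult_add_left M.a_ac)

lemma peval_smult: "peval T (Polynomial.smult c p) v = c \<odot> peval T p v"
  using T v
  by (induction p) (simp_all add: linop_in linop_smult smult_add_right smult_smult)

end

end

text \<open>
The subspaces of all \<open>p(T) v\<close> with \<open>degree p < k\<close> form an ascending chain, so some nonzero polynomial
\<open>p\<close> has \<open>p(T) v = 0\<close> for a nonzero vector \<open>v\<close>.  If \<open>p\<close> has the least possible degree and \<open>r\<close> is a root
of \<open>p\<close>, then \<open>p = (X - r) f\<close>, and \<open>f(T) v\<close> is an eigenvector: it cannot vanish, since \<open>f\<close> has smaller
degree.
\<close>

lemma eigenvector_exists:
  fixes V :: "('k::alg_closed_field, 'v, 'm) module_scheme" (structure)
  assumes V: "vectorspace class_ring V" "vectorspace.fin_dim class_ring V" "carrier V \<noteq> {\<zero>}"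
    and T: "T \<in> LinearCombinations.module_hom class_ring V V"
  obtains r v where "v \<in> carrier V" "v \<noteq> \<zero>" "T v = r \<odot> v"
proof -
  interpret kspace V using V(1) by (simp add: kspace_def)
  obtain v where v: "v \<in> carrier V" "v \<noteq> \<zero>" using V(3) M.zero_closed by blast
  \<comment> \<open>The bound is put on the coefficients, so that \<open>?U 0\<close> is the zero space.\<close>
  let ?U = "\<lambda>k. {peval T p v | p. \<forall>i\<ge>k. coeff p i = 0}"
  have "submodule class_ring (?U k) V" for k
  proof (rule submoduleI)
    show "?U k \<subseteq> carrier V" using T v by auto
    have "\<zero> = peval T 0 v \<and> (\<forall>i\<ge>k. coeff (0 :: 'k poly) i = 0)" by simp
    then show "\<zero> \<in> ?U k" by blast
    show "x \<oplus> y \<in> ?U k" if xy: "x \<in> ?U k" "y \<in> ?U k" for x y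
    proof -
      obtain p q where "x = peval T p v" "y = peval T q v"
        "\<forall>i\<ge>k. coeff p i = 0" "\<forall>i\<ge>k. coeff q i = 0" using xy by blast
      then show ?thesis
        using peval_add[OF T v(1), of p q] by (auto intro!: exI[of _ "p + q"])
    qed
    show "c \<odot> x \<in> ?U k" if x: "x \<in> ?U k" for c x
    proof -
      obtain p where "x = peval T p v" "\<forall>i\<ge>k. coeff p i = 0" using x by blast
      then show ?thesis
        using peval_smult[OF T v(1), of c p] by (auto intro!: exI[of _ "Polynomial.smult c p"])
    qed
  qed
  moreover have "?U k \<subseteq> ?U (Suc k)" for k by auto
  ultimately have "\<exists>k. ?U k = ?U (Suc k)" by (rule ascending_chain_stabilises[OF V(2)])
  then obtain k where k: "?U k = ?U (Suc k)" by (elim exE)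
  have "peval T (monom 1 k) v \<in> ?U (Suc k)"
    by (intro CollectI exI[of _ "monom 1 k"]) simp
  then have "peval T (monom 1 k) v \<in> ?U k" by (simp only: k)
  then obtain q where q: "peval T (monom 1 k) v = peval T q v" "coeff q k = 0"
    by blast
  let ?\<Phi> = "\<lambda>p. p \<noteq> 0 \<and> (\<exists>w\<in>carrier V. w \<noteq> \<zero> \<and> peval T p w = \<zero>)"
  have "coeff (monom 1 k - q) k \<noteq> 0" using q(2) by simp
  then have "monom 1 k - q \<noteq> 0" by force
  moreover have "peval T (monom 1 k - q) v = \<zero>"
  proof -
    have "peval T (monom 1 k - q) v
        = peval T (monom 1 k) v \<oplus> peval T (Polynomial.smult (- 1) q) v"
      using peval_add[OF T v(1), of "monom 1 k" "- q"] by simp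
    also have "\<dots> = \<zero>"
      using peval_smult[OF T v(1), of "- 1" q] peval_in[OF T v(1)] q(1)
      by (simp add: neg_smult M.r_neg)
    finally show ?thesis .
  qed
  ultimately have "?\<Phi> (monom 1 k - q)" using v by blast
  then obtain p where p: "?\<Phi> p" "\<And>p'. ?\<Phi> p' \<Longrightarrow> degree p \<le> degree p'"
    using ex_has_least_nat[of ?\<Phi> "monom 1 k - q" degree] by blast
  then obtain w where w: "w \<in> carrier V" "w \<noteq> \<zero>" "peval T p w = \<zero>" by blast
  have "degree p \<noteq> 0"
  proof
    assume "degree p = 0"
    then obtain a where a: "p = [:a:]" using degree_eq_zeroE by blast
    then have "a \<odot> w = \<zero>" using w T by (simp add: linop_zero)
    moreover have "a \<noteq> 0" using a p(1) by simp
    ultimately show False using smult_eq_zero w by blast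
  qed
  then obtain r where "poly p r = 0" using alg_closed_imp_poly_has_root by blast
  then obtain f where f: "p = [:- r, 1:] * f" using poly_eq_0_iff_dvd by blast
  let ?u = "peval T f w"
  have u: "?u \<in> carrier V" using peval_in[OF T w(1)] .
  have "f \<noteq> 0" using f p(1) by auto
  then have "degree f < degree p" unfolding f by (subst degree_mult_eq) auto
  then have "?u \<noteq> \<zero>" using p(2)[of f] \<open>f \<noteq> 0\<close> w by force
  moreover have "T ?u = r \<odot> ?u"
  proof -
    have "p = pCons 0 f + Polynomial.smult (- r) f" using f by simp
    then have "peval T p w = T ?u \<oplus> (- r) \<odot> ?u"
      using peval_add[OF T w(1), of "pCons 0 f" "Polynomial.smult (- r) f"]
        peval_smult[OF T w(1), of "- r" f] u w(1) T by (simp add: linop_in)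
    then have "T ?u \<oplus> \<ominus> (r \<odot> ?u) = \<zero>" using w(3) u by (simp add: neg_smult)
    then show ?thesis using u T
      by (metis M.minus_equality M.minus_minus M.a_inv_closed linop_in smult_in)
  qed
  ultimately show ?thesis using that u by blast
qed

section \<open>Commutators and nilpotent operators\<close>

context kspace
begin

text \<open>
The operator \<open>Y \<mapsto> N Y - Y N\<close> acts as a derivation, so the commutator of a power of \<open>N\<close> with \<open>Y\<close> is
\<open>[N\<^sup>m\<^sup>+\<^sup>1, Y] = (m + 1) W N\<^sup>m\<close> as soon as \<open>W = [N, Y]\<close> commutes with \<open>N\<close>.
\<close>

lemma funpow_commutator:
  assumes N: "linop N" and Y: "linop Y" and W: "linop W"
    and NY: "\<And>v. v \<in> carrier V \<Longrightarrow> N (Y v) = Y (N v) \<oplus> W v"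
    and NW: "\<And>v. v \<in> carrier V \<Longrightarrow> N (W v) = W (N v)"
    and v: "v \<in> carrier V"
  shows "(N ^^ Suc m) (Y v) = Y ((N ^^ Suc m) v) \<oplus> of_nat (Suc m) \<odot> W ((N ^^ m) v)"
proof (induction m)
  case 0
  then show ?case using NY[OF v] linop_in[OF W v] by simp
next
  case (Suc m)
  define u where "u = (N ^^ m) v"
  have u: "u \<in> carrier V" unfolding u_def using linop_in[OF linop_funpow[OF N] v] .
  note [simp] = u linop_in[OF N] linop_in[OF Y] linop_in[OF W]
  have "(N ^^ Suc (Suc m)) (Y v) = N (Y (N u) \<oplus> of_nat (Suc m) \<odot> W u)"
    using Suc by (simp add: u_def)
  also have "\<dots> = (Y (N (N u)) \<oplus> W (N u)) \<oplus> of_nat (Suc m) \<odot> W (N u)"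
    by (simp add: linop_add[OF N] linop_smult[OF N] NY NW del: of_nat_Suc)
  also have "\<dots> = Y (N (N u)) \<oplus> (1 \<odot> W (N u) \<oplus> of_nat (Suc m) \<odot> W (N u))"
    by (simp add: M.a_assoc del: of_nat_Suc)
  also have "\<dots> = Y (N (N u)) \<oplus> of_nat (Suc (Suc m)) \<odot> W (N u)"
    by (subst smult_add_left[symmetric]) auto
  finally show ?case by (simp add: u_def)
qed

lemma generalised_kernel_submodule:
  assumes "linop N"
  shows "submodule class_ring {v \<in> carrier V. \<exists>m. (N ^^ m) v = \<zero>} V"
proof -
  have mono: "(N ^^ (m + k)) v = \<zero>" if "(N ^^ m) v = \<zero>" "v \<in> carrier V" for m k v
    using that linop_zero[OF linop_funpow[OF assms, of k]]
    by (simp add: funpow_add add.commute[of m])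
  show ?thesis
  proof (intro submoduleI)
    fix v w
    assume "v \<in> {v \<in> carrier V. \<exists>m. (N ^^ m) v = \<zero>}" "w \<in> {v \<in> carrier V. \<exists>m. (N ^^ m) v = \<zero>}"
    then obtain m k where *: "v \<in> carrier V" "w \<in> carrier V" "(N ^^ m) v = \<zero>" "(N ^^ k) w = \<zero>"
      by blast
    then have "(N ^^ (m + k)) v = \<zero>" "(N ^^ (m + k)) w = \<zero>"
      using mono[of m v k] mono[of k w m] by (auto simp: add.commute)
    then have "(N ^^ (m + k)) (v \<oplus> w) = \<zero>"
      using * by (simp add: linop_add[OF linop_funpow[OF assms]])
    then show "v \<oplus> w \<in> {v \<in> carrier V. \<exists>m. (N ^^ m) v = \<zero>}" using * by blast
  next
    fix c v
    assume "v \<in> {v \<in> carrier V. \<exists>m. (N ^^ m) v = \<zero>}"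
    then obtain m where *: "v \<in> carrier V" "(N ^^ m) v = \<zero>" by blast
    then have "(N ^^ m) (c \<odot> v) = \<zero>" by (simp add: linop_smult[OF linop_funpow[OF assms]])
    then show "c \<odot> v \<in> {v \<in> carrier V. \<exists>m. (N ^^ m) v = \<zero>}" using * by auto
  qed (auto intro: exI[of _ 0])
qed

text \<open>
A minimal nonzero subspace \<open>P\<close> that is stable under \<open>S\<close> consists of common zeros: each \<open>N \<in> S\<close> has a
nonzero kernel on \<open>P\<close>, which is again stable because the operators commute, and hence is all of \<open>P\<close>.
\<close>

lemma common_kernel:
  assumes fd: "fin_dim" and ne: "carrier V \<noteq> {\<zero>}"
    and lin: "\<And>N. N \<in> S \<Longrightarrow> linop N"
    and comm: "\<And>N N' v. \<lbrakk>N \<in> S; N' \<in> S; v \<in> carrier V\<rbrakk> \<Longrightarrow> N (N' v) = N' (N v)"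
    and nil: "\<And>N v. \<lbrakk>N \<in> S; v \<in> carrier V\<rbrakk> \<Longrightarrow> \<exists>m. (N ^^ m) v = \<zero>"
  obtains v where "v \<in> carrier V" "v \<noteq> \<zero>" "\<And>N. N \<in> S \<Longrightarrow> N v = \<zero>"
proof -
  let ?\<Phi> = "\<lambda>P. submodule class_ring P V \<and> P \<noteq> {\<zero>} \<and> (\<forall>N\<in>S. \<forall>v\<in>P. N v \<in> P)"
  have "?\<Phi> (carrier V)"
    using ne lin by (auto intro!: submoduleI intro: linop_in)
  then obtain P where P: "?\<Phi> P" and min: "\<And>Q. \<lbrakk>?\<Phi> Q; Q \<subseteq> P\<rbrakk> \<Longrightarrow> Q = P"
    using minimal_subspace[OF fd, of ?\<Phi> "carrier V"] by blast
  interpret P: submodule class_ring P V using P by blast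
  have zero: "N v = \<zero>" if N: "N \<in> S" and v: "v \<in> P" for N v
  proof -
    let ?Q = "{v \<in> P. N v = \<zero>}"
    obtain u where u: "u \<in> P" "u \<noteq> \<zero>" using P P.zero_closed by blast
    have in_P: "(N ^^ m) u \<in> P" for m
      using P N u(1) by (induction m) auto
    define m where "m = (LEAST m. (N ^^ m) u = \<zero>)"
    have "(N ^^ m) u = \<zero>"
      unfolding m_def using nil[OF N] u(1) P.subset LeastI_ex by (metis (mono_tags, lifting) subsetD)
    moreover have "m \<noteq> 0" using calculation u(2) by (metis funpow_0)
    ultimately obtain m' where m': "m = Suc m'" using not0_implies_Suc by blast
    have "(N ^^ m') u \<noteq> \<zero>" 
      using not_less_Least[of m' "\<lambda>m. (N ^^ m) u = \<zero>"] m' unfolding m_def by simp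
    moreover have "N ((N ^^ m') u) = \<zero>" using \<open>(N ^^ m) u = \<zero>\<close> m' by simp
    ultimately have "?Q \<noteq> {\<zero>}" using in_P by blast
    moreover have "submodule class_ring ?Q V"
      using P.subset linop_zero[OF lin[OF N]] linop_add[OF lin[OF N]] linop_smult[OF lin[OF N]]
      by (intro submoduleI) (auto simp: subset_iff)
    moreover have "\<forall>N'\<in>S. \<forall>v\<in>?Q. N' v \<in> ?Q"
      using P comm[OF N] P.subset linop_zero[OF lin] by (auto simp: subset_iff)
    ultimately have "?Q = P" using min by blast
    then show ?thesis using v by blast
  qed
  obtain u where "u \<in> P" "u \<noteq> \<zero>" using P P.zero_closed by blast
  then show ?thesis using that zero P.subset by blast
qed

end

text \<open>
This is where characteristic 0 enters.  Let \<open>m\<close> be least with \<open>ker N\<^sup>m = ker N\<^sup>m\<^sup>+\<^sup>1\<close>; then \<open>m > 0\<close> as \<open>N\<close>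
is singular.  For \<open>v \<in> ker N\<^sup>m\<close> the commutator formula gives \<open>N\<^sup>m\<^sup>+\<^sup>1 Y v = 0\<close>, hence \<open>N\<^sup>m Y v = 0\<close> by the
choice of \<open>m\<close>, hence \<open>m W N\<^sup>m\<^sup>-\<^sup>1 v = 0\<close> by the formula for the exponent \<open>m\<close>.  So \<open>W\<close> kills
\<open>N\<^sup>m\<^sup>-\<^sup>1 v\<close>, and by minimality of \<open>m\<close> this vector is nonzero for some \<open>v \<in> ker N\<^sup>m\<close>.
\<close>

lemma commutator_singular:
  fixes V :: "('k::field_char_0, 'v, 'm) module_scheme" (structure)
  assumes V: "vectorspace class_ring V" "vectorspace.fin_dim class_ring V"
    and N: "N \<in> LinearCombinations.module_hom class_ring V V"
    and Y: "Y \<in> LinearCombinations.module_hom class_ring V V"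
    and W: "W \<in> LinearCombinations.module_hom class_ring V V"
    and NY: "\<And>v. v \<in> carrier V \<Longrightarrow> N (Y v) = Y (N v) \<oplus> W v"
    and NW: "\<And>v. v \<in> carrier V \<Longrightarrow> N (W v) = W (N v)"
    and u: "u \<in> carrier V" "u \<noteq> \<zero>" "N u = \<zero>"
  obtains v where "v \<in> carrier V" "v \<noteq> \<zero>" "W v = \<zero>"
proof -
  interpret kspace V using V(1) by (simp add: kspace_def)
  let ?K = "\<lambda>m. {v \<in> carrier V. (N ^^ m) v = \<zero>}"
  note pow = linop_funpow[OF N]
  have "submodule class_ring (?K m) V" for m by (rule kernel_submodule[OF pow])
  moreover have "?K m \<subseteq> ?K (Suc m)" for m using linop_zero[OF N] by auto
  ultimately have ex: "\<exists>m. ?K m = ?K (Suc m)" by (rule ascending_chain_stabilises[OF V(2)])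
  define m where "m = (LEAST m. ?K m = ?K (Suc m))"
  have m: "?K m = ?K (Suc m)" unfolding m_def using ex by (rule LeastI_ex)
  have "?K 0 \<noteq> ?K (Suc 0)" using u by auto
  then have "m \<noteq> 0" using m by metis
  then obtain k where k: "m = Suc k" using not0_implies_Suc by blast
  have "?K k \<noteq> ?K (Suc k)" 
    using not_less_Least[of k "\<lambda>m. ?K m = ?K (Suc m)"] k unfolding m_def by linarith
  then obtain v where v: "v \<in> carrier V" "(N ^^ Suc k) v = \<zero>" "(N ^^ k) v \<noteq> \<zero>"
    using linop_zero[OF N] by auto
  have Yv: "Y v \<in> carrier V" using linop_in[OF Y v(1)] .
  have N1: "(N ^^ Suc m) v = \<zero>" using v(2) k linop_zero[OF N] by simp
  have "(N ^^ Suc m) (Y v) = Y ((N ^^ Suc m) v) \<oplus> of_nat (Suc m) \<odot> W ((N ^^ m) v)"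
    by (rule funpow_commutator[OF N Y W NY NW v(1)])
  also have "\<dots> = \<zero>"
    unfolding N1 using v(2) k linop_zero[OF Y] linop_zero[OF W] by simp
  finally have "Y v \<in> ?K m" using m Yv by blast
  then have "\<zero> = Y ((N ^^ Suc k) v) \<oplus> of_nat (Suc k) \<odot> W ((N ^^ k) v)"
    using funpow_commutator[OF N Y W NY NW v(1), of k] k by simp
  then have "of_nat (Suc k) \<odot> W ((N ^^ k) v) = \<zero>"
    unfolding v(2) linop_zero[OF Y] using linop_in[OF W linop_in[OF pow v(1)]]
    by (simp del: of_nat_Suc)
  then have "W ((N ^^ k) v) = \<zero>"
    using smult_eq_zero[OF linop_in[OF W linop_in[OF pow v(1)]]] of_nat_neq_0 by blast
  then show ?thesis using that v linop_in[OF pow v(1)] by blast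
qed

section \<open>Derived series and modules of a Lie algebra\<close>

sublocale lie_algebra \<subseteq> kspace L
  by (simp add: kspace_def vectorspace_axioms)

sublocale lie_module \<subseteq> M: kspace M
  by (simp add: kspace_def M.vectorspace_axioms)

context lie_algebra
begin

lemma bracket_linop: "x \<in> carrier L \<Longrightarrow> linop (bracket L x)"
  by (intro linopI) (auto intro: bracket_closed bracket_add_right bracket_smult_right)

lemma bracket_antisym:
  assumes "x \<in> carrier L" "y \<in> carrier L"
  shows "bracket L y x = \<ominus>\<^bsub>L\<^esub> bracket L x y"
proof -
  note [simp] = assms bracket_closed
  have "bracket L (x \<oplus>\<^bsub>L\<^esub> y) (x \<oplus>\<^bsub>L\<^esub> y) = \<zero>\<^bsub>L\<^esub>" by (intro bracket_self) simp
  then have "bracket L x y \<oplus>\<^bsub>L\<^esub> bracket L y x = \<zero>\<^bsub>L\<^esub>"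
    using bracket_self[OF assms(1)] bracket_self[OF assms(2)]
    by (simp add: bracket_add_left bracket_add_right M.a_comm)
  then show ?thesis by (simp add: add_eq_zero_iff)
qed

lemma derived_series_submodule: "submodule class_ring (derived_series L n) L"
proof (induction n)
  case 0
  then show ?case by (auto intro: submoduleI)
next
  case (Suc n)
  have "{bracket L x y | x y. x \<in> derived_series L n \<and> y \<in> derived_series L n} \<subseteq> carrier L"
    using submodule.subset[OF Suc] bracket_closed by blast
  then show ?case by (simp add: span_is_submodule)
qed

lemma derived_series_carrier: "x \<in> derived_series L n \<Longrightarrow> x \<in> carrier L"
  using submodule.subset[OF derived_series_submodule] by blast

lemma bracket_in_derived_series:
  assumes "x \<in> derived_series L n" "y \<in> derived_series L n"
  shows "bracket L x y \<in> derived_series L (Suc n)"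
proof -
  let ?B = "{bracket L x y | x y. x \<in> derived_series L n \<and> y \<in> derived_series L n}"
  have "?B \<subseteq> carrier L" using derived_series_carrier bracket_closed by blast
  then have "?B \<subseteq> span ?B" by (rule in_own_span)
  then show ?thesis using assms by auto
qed

lemma derived_series_Suc_least:
  assumes "submodule class_ring P L"
    and "\<And>x y. \<lbrakk>x \<in> derived_series L n; y \<in> derived_series L n\<rbrakk> \<Longrightarrow> bracket L x y \<in> P"
  shows "derived_series L (Suc n) \<subseteq> P"
proof -
  have "{bracket L x y | x y. x \<in> derived_series L n \<and> y \<in> derived_series L n} \<subseteq> P"
    using assms(2) by blast
  then show ?thesis using span_is_subset[OF _ assms(1)] by simp
qed

text \<open>
By the Jacobi identity, the bracket of \<open>x\<close> with a generator \<open>[a, b]\<close> of the next term is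
\<open>- [a, [b, x]] - [b, [x, a]]\<close>, and \<open>[b, x]\<close> and \<open>[x, a]\<close> stay in the previous term.
\<close>

lemma derived_series_ideal:
  "\<lbrakk>x \<in> carrier L; z \<in> derived_series L n\<rbrakk> \<Longrightarrow> bracket L x z \<in> derived_series L n"
proof (induction n arbitrary: x z)
  case 0
  then show ?case by (simp add: bracket_closed)
next
  case (Suc n)
  let ?D = "derived_series L (Suc n)"
  interpret D: submodule class_ring ?D L by (rule derived_series_submodule)
  have "?D \<subseteq> {z \<in> carrier L. bracket L x z \<in> ?D}"
  proof (rule derived_series_Suc_least)
    show "submodule class_ring {z \<in> carrier L. bracket L x z \<in> ?D} L"
      using linop_zero[OF bracket_linop[OF Suc.prems(1)]] Suc.prems(1)
      by (intro submoduleI)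
        (auto simp: bracket_add_right bracket_smult_right simp del: derived_series.simps)
  next
    fix a b
    assume ab: "a \<in> derived_series L n" "b \<in> derived_series L n"
    note [simp] = derived_series_carrier[OF ab(1)] derived_series_carrier[OF ab(2)]
      Suc.prems(1) bracket_closed
    have "bracket L b x \<in> derived_series L n"
      using bracket_antisym[of x b] Suc.IH[OF Suc.prems(1) ab(2)]
        submodule_neg[OF derived_series_submodule] by simp
    then have 1: "bracket L a (bracket L b x) \<in> ?D"
      using bracket_in_derived_series[OF ab(1)] by blast
    have 2: "bracket L b (bracket L x a) \<in> ?D"
      using bracket_in_derived_series[OF ab(2) Suc.IH[OF Suc.prems(1) ab(1)]] .
    have "bracket L a (bracket L b x) \<oplus>\<^bsub>L\<^esub> bracket L b (bracket L x a)
        \<oplus>\<^bsub>L\<^esub> bracket L x (bracket L a b) = \<zero>\<^bsub>L\<^esub>"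
      using jacobi[of a b x] by simp
    then have "bracket L x (bracket L a b)
        = \<ominus>\<^bsub>L\<^esub> (bracket L a (bracket L b x) \<oplus>\<^bsub>L\<^esub> bracket L b (bracket L x a))"
      by (simp add: add_eq_zero_iff)
    also have "\<dots> \<in> ?D" using submodule_neg[OF derived_series_submodule] 1 2 by blast
    finally show "bracket L a b \<in> {z \<in> carrier L. bracket L x z \<in> ?D}" by simp
  qed
  then show ?case using Suc.prems(2) by blast
qed

lemma derived_series_ideal':
  assumes "x \<in> carrier L" "z \<in> derived_series L n"
  shows "bracket L z x \<in> derived_series L n"
  using bracket_antisym[of x z] derived_series_ideal[OF assms] assms
    submodule_neg[OF derived_series_submodule] derived_series_carrier by simp

lemma derived_series_Suc_subset: "derived_series L (Suc n) \<subseteq> derived_series L n"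
  using derived_series_ideal derived_series_carrier
  by (intro derived_series_Suc_least derived_series_submodule) blast

end

context lie_module
begin

lemma act_linop: "x \<in> carrier L \<Longrightarrow> M.linop (act M x)"
  by (intro M.linopI) (auto intro: act_closed act_add_right act_smult_right)

lemma act_act:
  assumes "x \<in> carrier L" "y \<in> carrier L" "v \<in> carrier M"
  shows "act M x (act M y v) = act M y (act M x v) \<oplus>\<^bsub>M\<^esub> act M (bracket L x y) v"
proof -
  note [simp] = assms act_closed
  show ?thesis
    by (simp add: act_bracket M.minus_eq M.M.a_lcomm M.M.r_neg)
qed

lemma act_zero_left: "v \<in> carrier M \<Longrightarrow> act M \<zero>\<^bsub>L\<^esub> v = \<zero>\<^bsub>M\<^esub>"
  using act_smult_left[of "\<zero>\<^bsub>L\<^esub>" v 0] act_closed[of "\<zero>\<^bsub>L\<^esub>" v] by simp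

lemma annihilator_submodule:
  "submodule class_ring {x \<in> carrier L. \<forall>v\<in>carrier M. act M x v = \<zero>\<^bsub>M\<^esub>} L"
  by (intro L.submoduleI) (auto simp: act_zero_left act_add_left act_smult_left)

lemma irreducibleD:
  assumes "irreducible_lie_module L M" "submodule class_ring P M" "P \<noteq> {\<zero>\<^bsub>M\<^esub>}"
    and "\<And>x v. \<lbrakk>x \<in> carrier L; v \<in> P\<rbrakk> \<Longrightarrow> act M x v \<in> P"
  shows "P = carrier M"
  using assms lie_module_axioms
  unfolding irreducible_lie_module_def lie_submodule_def by blast

end

section \<open>Lie's theorem\<close>

text \<open>
For \<open>y \<in> D\<close> and \<open>x \<in> L\<close> the element \<open>w = [y, x]\<close> lies in \<open>D\<close>, so it commutes with \<open>y\<close> on \<open>M\<close>.  For an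
eigenvalue \<open>a\<close> of \<open>y\<close> the operator \<open>y - a\<close> is singular and has the same commutators as \<open>y\<close>, so
\<open>w = [y - a, x]\<close> is singular by \<open>commutator_singular\<close>.  Its generalised kernel is stable
under \<open>L\<close>, again because \<open>[w, p] \<in> D\<close> commutes with \<open>w\<close>; so it is everything, and all operators in
\<open>[D, L]\<close> are nilpotent.  Their common kernel is nonzero and stable under \<open>L\<close>, so \<open>[D, L]\<close> acts as zero.
Thus \<open>D\<close> commutes with \<open>L\<close>, and Schur's lemma applies.
\<close>

lemma commuting_ideal_acts_by_scalars:
  fixes L :: "('k::{alg_closed_field, field_char_0}, 'g) lie_algebra"
    and M :: "('k, 'g, 'v) lie_module"
  assumes irr: "irreducible_lie_module L M" and fd: "vectorspace.fin_dim class_ring M"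
    and sub: "D \<subseteq> carrier L"
    and ideal: "\<And>x z. \<lbrakk>x \<in> carrier L; z \<in> D\<rbrakk> \<Longrightarrow> bracket L z x \<in> D"
    and comm: "\<And>y z v. \<lbrakk>y \<in> D; z \<in> D; v \<in> carrier M\<rbrakk> \<Longrightarrow> act M y (act M z v) = act M z (act M y v)"
    and z: "z \<in> D"
  obtains a where "\<And>v. v \<in> carrier M \<Longrightarrow> act M z v = a \<odot>\<^bsub>M\<^esub> v"
proof -
  interpret lie_module L M using irr by (simp add: irreducible_lie_module_def)
  have ne: "carrier M \<noteq> {\<zero>\<^bsub>M\<^esub>}" using irr by (simp add: irreducible_lie_module_def)
  have DL: "y \<in> carrier L" if "y \<in> D" for y using that sub by blast
  have eigen: "\<exists>a v. v \<in> carrier M \<and> v \<noteq> \<zero>\<^bsub>M\<^esub> \<and> act M y v = a \<odot>\<^bsub>M\<^esub> v" if "y \<in> D" for y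
    using eigenvector_exists[OF M.vectorspace_axioms fd ne act_linop[OF DL[OF that]]] by metis
  have nilpotent: "\<exists>m. (act M (bracket L y x) ^^ m) v = \<zero>\<^bsub>M\<^esub>"
    if y: "y \<in> D" and x: "x \<in> carrier L" and v: "v \<in> carrier M" for x y v
  proof -
    let ?w = "bracket L y x"
    have w: "?w \<in> D" using ideal[OF x y] .
    obtain a u where u: "u \<in> carrier M" "u \<noteq> \<zero>\<^bsub>M\<^esub>" "act M y u = a \<odot>\<^bsub>M\<^esub> u"
      using eigen[OF y] by blast
    let ?N = "\<lambda>v. act M y v \<oplus>\<^bsub>M\<^esub> (- a) \<odot>\<^bsub>M\<^esub> v"
    note [simp] = act_closed x DL[OF y] DL[OF w]
    obtain t where t: "t \<in> carrier M" "t \<noteq> \<zero>\<^bsub>M\<^esub>" "act M ?w t = \<zero>\<^bsub>M\<^esub>"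
    proof (rule commutator_singular[OF M.vectorspace_axioms fd,
          of ?N "act M x" "act M ?w" u])
      show "M.linop ?N" by (intro M.linop_shift act_linop) simp
      show "M.linop (act M x)" "M.linop (act M ?w)" by (intro act_linop; simp)+
      show "?N (act M x v) = act M x (?N v) \<oplus>\<^bsub>M\<^esub> act M ?w v" if "v \<in> carrier M" for v
        using that by (simp add: act_act[of y x] act_add_right act_smult_right M.M.a_ac)
      show "?N (act M ?w v) = act M ?w (?N v)" if "v \<in> carrier M" for v
        using that by (simp add: comm[OF y w] act_add_right act_smult_right)
      show "?N u = \<zero>\<^bsub>M\<^esub>" using u by (simp add: M.neg_smult M.M.r_neg)
    qed (use u in auto)
    let ?P = "{v \<in> carrier M. \<exists>m. (act M ?w ^^ m) v = \<zero>\<^bsub>M\<^esub>}"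
    note lin_w = act_linop[OF DL[OF w]]
    have "?P = carrier M"
    proof (rule irreducibleD[OF irr])
      show "submodule class_ring ?P M" by (rule M.generalised_kernel_submodule[OF lin_w])
      have "(act M ?w ^^ 1) t = \<zero>\<^bsub>M\<^esub>" using t(3) by simp
      then show "?P \<noteq> {\<zero>\<^bsub>M\<^esub>}" using t(1,2) by blast
      fix p v
      assume p: "p \<in> carrier L" and "v \<in> ?P"
      then obtain m where v: "v \<in> carrier M" "(act M ?w ^^ m) v = \<zero>\<^bsub>M\<^esub>" by blast
      have wp: "bracket L ?w p \<in> D" using ideal[OF p w] .
      note lins = lin_w act_linop[OF p] act_linop[OF DL[OF wp]]
      have "(act M ?w ^^ Suc m) (act M p v) = act M p ((act M ?w ^^ Suc m) v)
          \<oplus>\<^bsub>M\<^esub> of_nat (Suc m) \<odot>\<^bsub>M\<^esub> act M (bracket L ?w p) ((act M ?w ^^ m) v)"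
        by (rule M.funpow_commutator[OF lins act_act[OF DL[OF w] p] comm[OF w wp] v(1)])
      also have "\<dots> = \<zero>\<^bsub>M\<^esub>"
        using v(2) lins[THEN M.linop_zero] by simp
      finally show "act M p v \<in> ?P" using p v(1) act_closed by blast
    qed
    then show ?thesis using v by blast
  qed
  obtain t where t: "t \<in> carrier M" "t \<noteq> \<zero>\<^bsub>M\<^esub>"
    "\<And>y x. \<lbrakk>y \<in> D; x \<in> carrier L\<rbrakk> \<Longrightarrow> act M (bracket L y x) t = \<zero>\<^bsub>M\<^esub>"
  proof (rule M.common_kernel[OF fd ne, of "{act M (bracket L y x) | y x. y \<in> D \<and> x \<in> carrier L}"])
    fix N
    assume "N \<in> {act M (bracket L y x) | y x. y \<in> D \<and> x \<in> carrier L}"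
    then show "M.linop N" using act_linop DL ideal by blast
  next
    fix N N' v
    assume "N \<in> {act M (bracket L y x) | y x. y \<in> D \<and> x \<in> carrier L}"
      "N' \<in> {act M (bracket L y x) | y x. y \<in> D \<and> x \<in> carrier L}" "v \<in> carrier M"
    then show "N (N' v) = N' (N v)" using comm ideal by blast
  next
    fix N v
    assume "N \<in> {act M (bracket L y x) | y x. y \<in> D \<and> x \<in> carrier L}" "v \<in> carrier M"
    then show "\<exists>m. (N ^^ m) v = \<zero>\<^bsub>M\<^esub>" using nilpotent by blast
  next
    fix v
    assume "v \<in> carrier M" "v \<noteq> \<zero>\<^bsub>M\<^esub>"
      "\<And>N. N \<in> {act M (bracket L y x) | y x. y \<in> D \<and> x \<in> carrier L} \<Longrightarrow> N v = \<zero>\<^bsub>M\<^esub>"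
    then show thesis using that by blast
  qed
  let ?P = "{v \<in> carrier M. \<forall>y\<in>D. \<forall>x\<in>carrier L. act M (bracket L y x) v = \<zero>\<^bsub>M\<^esub>}"
  have "?P = carrier M"
  proof (rule irreducibleD[OF irr])
    show "submodule class_ring ?P M"
      using ideal DL act_linop[THEN M.linop_zero]
      by (intro M.submoduleI) (auto simp: act_add_right act_smult_right)
    show "?P \<noteq> {\<zero>\<^bsub>M\<^esub>}" using t by blast
    fix p v
    assume p: "p \<in> carrier L" and v: "v \<in> ?P"
    have "act M (bracket L y x) (act M p v) = \<zero>\<^bsub>M\<^esub>" if "y \<in> D" "x \<in> carrier L" for x y
      using act_act[of "bracket L y x" p v] v p that ideal[of x y] DL
        act_linop[OF p, THEN M.linop_zero] by simp
    then show "act M p v \<in> ?P" using act_closed p v by blast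
  qed
  then have commutes: "act M z (act M x v) = act M x (act M z v)"
    if x: "x \<in> carrier L" and v: "v \<in> carrier M" for x v
  proof -
    have "v \<in> ?P" using v \<open>?P = carrier M\<close> by simp
    then have "act M (bracket L z x) v = \<zero>\<^bsub>M\<^esub>" using z x by blast
    then show ?thesis using act_act[OF DL[OF z] x v] act_closed DL[OF z] x v by simp
  qed
  obtain a u where u: "u \<in> carrier M" "u \<noteq> \<zero>\<^bsub>M\<^esub>" "act M z u = a \<odot>\<^bsub>M\<^esub> u"
    using eigen[OF z] by blast
  have "{v \<in> carrier M. act M z v = a \<odot>\<^bsub>M\<^esub> v} = carrier M"
  proof (rule irreducibleD[OF irr])
    show "submodule class_ring {v \<in> carrier M. act M z v = a \<odot>\<^bsub>M\<^esub> v} M"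
      using DL[OF z] act_linop[THEN M.linop_zero]
      by (intro M.submoduleI)
        (auto simp: act_add_right act_smult_right M.smult_add_right M.smult_smult mult.commute)
    show "{v \<in> carrier M. act M z v = a \<odot>\<^bsub>M\<^esub> v} \<noteq> {\<zero>\<^bsub>M\<^esub>}" using u by blast
    show "act M x v \<in> {v \<in> carrier M. act M z v = a \<odot>\<^bsub>M\<^esub> v}"
      if "x \<in> carrier L" "v \<in> {v \<in> carrier M. act M z v = a \<odot>\<^bsub>M\<^esub> v}" for x v
      using that commutes by (simp add: act_closed act_smult_right)
  qed
  then show ?thesis using that by blast
qed

text \<open>
Lie's theorem in the form used for cohomology.  Suppose that the term \<open>n + 2\<close> of the derived series acts
as zero.  Then the term \<open>n + 1\<close> acts by commuting operators, hence by scalars.  A generator \<open>[p, q]\<close> of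
it equals \<open>[p - r, q]\<close> for an eigenvalue \<open>r\<close> of \<open>p\<close>, and as a scalar it commutes with \<open>p - r\<close>; by
\<open>commutator_singular\<close> it is a singular scalar, that is, 0.  The argument needs \<open>p\<close> and
\<open>q\<close> and so stops at the derived algebra: \<open>L\<close> itself may act by nonzero scalars.
\<close>

theorem derived_algebra_annihilates_irreducible:
  fixes L :: "('k::{alg_closed_field, field_char_0}, 'g) lie_algebra"
    and M :: "('k, 'g, 'v) lie_module"
  assumes solv: "solvable_lie_algebra L"
    and irr: "irreducible_lie_module L M" and fd: "vectorspace.fin_dim class_ring M"
    and x: "x \<in> derived_series L 1" and v: "v \<in> carrier M"
  shows "act M x v = \<zero>\<^bsub>M\<^esub>"
proof -
  interpret lie_module L M using irr by (simp add: irreducible_lie_module_def)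
  let ?D = "derived_series L"
  let ?Ann = "{x \<in> carrier L. \<forall>v\<in>carrier M. act M x v = \<zero>\<^bsub>M\<^esub>}"
  have step: "?D (Suc n) \<subseteq> ?Ann" if IH: "?D (Suc (Suc n)) \<subseteq> ?Ann" for n
  proof (rule L.derived_series_Suc_least[OF annihilator_submodule])
    fix p q
    assume pq: "p \<in> ?D n" "q \<in> ?D n"
    let ?z = "bracket L p q"
    have z: "?z \<in> ?D (Suc n)" using L.bracket_in_derived_series[OF pq] .
    note [simp] = L.derived_series_carrier[OF pq(1)] L.derived_series_carrier[OF pq(2)]
      L.bracket_closed act_closed
    have comm: "act M y (act M y' v) = act M y' (act M y v)"
      if y: "y \<in> ?D (Suc n)" "y' \<in> ?D (Suc n)" and v: "v \<in> carrier M" for y y' v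
    proof -
      note yL = L.derived_series_carrier[OF y(1)] L.derived_series_carrier[OF y(2)]
      have "act M (bracket L y y') v = \<zero>\<^bsub>M\<^esub>"
        using L.bracket_in_derived_series[OF y] IH v by blast
      then show ?thesis using act_act[OF yL v] yL v by simp
    qed
    obtain a where a: "\<And>v. v \<in> carrier M \<Longrightarrow> act M ?z v = a \<odot>\<^bsub>M\<^esub> v"
      using commuting_ideal_acts_by_scalars[OF irr fd, of "?D (Suc n)" ?z, OF _ _ comm z]
        L.derived_series_carrier L.derived_series_ideal' by blast
    have ne: "carrier M \<noteq> {\<zero>\<^bsub>M\<^esub>}" using irr by (simp add: irreducible_lie_module_def)
    obtain r u where u: "u \<in> carrier M" "u \<noteq> \<zero>\<^bsub>M\<^esub>" "act M p u = r \<odot>\<^bsub>M\<^esub> u"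
      using eigenvector_exists[OF M.vectorspace_axioms fd ne act_linop[of p]]
        L.derived_series_carrier[OF pq(1)] by metis
    let ?N = "\<lambda>v. act M p v \<oplus>\<^bsub>M\<^esub> (- r) \<odot>\<^bsub>M\<^esub> v"
    obtain t where t: "t \<in> carrier M" "t \<noteq> \<zero>\<^bsub>M\<^esub>" "act M ?z t = \<zero>\<^bsub>M\<^esub>"
    proof (rule commutator_singular[OF M.vectorspace_axioms fd, of ?N "act M q" "act M ?z" u])
      show "M.linop ?N" by (intro M.linop_shift act_linop) simp
      show "M.linop (act M q)" "M.linop (act M ?z)" by (intro act_linop; simp)+
      show "?N (act M q v) = act M q (?N v) \<oplus>\<^bsub>M\<^esub> act M ?z v" if "v \<in> carrier M" for v
        using that by (simp add: act_act[of p q] act_add_right act_smult_right M.M.a_ac)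
      show "?N (act M ?z v) = act M ?z (?N v)" if "v \<in> carrier M" for v
        using that by (simp add: a M.smult_add_right act_smult_right M.smult_smult mult.commute)
      show "?N u = \<zero>\<^bsub>M\<^esub>" using u by (simp add: M.neg_smult M.M.r_neg)
    qed (use u in auto)
    then have "a = 0" using a[OF t(1)] M.smult_eq_zero by metis
    then show "?z \<in> ?Ann" using a by simp
  qed
  obtain N where N: "?D N = {\<zero>\<^bsub>L\<^esub>}" using solv by (auto simp: solvable_lie_algebra_def)
  have "?D (Suc N) \<subseteq> ?Ann"
    using L.derived_series_Suc_subset[of N] N by (auto simp: act_zero_left)
  then have "?D (Suc (N - k)) \<subseteq> ?Ann" for k
  proof (induction k)
    case (Suc k)
    then show ?case
      using step[of "N - Suc k"] by (cases "k < N") (auto simp: Suc_diff_Suc simp del: derived_series.simps)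
  qed simp
  from this[of N] show ?thesis using x v by auto
qed

section \<open>Quotients of modules\<close>

text \<open>
The axioms of a vector space, and below those of a Lie module, are transported along any surjection that
respects the operations.  This covers quotients, and also the adjoint module with the identity as the map.
\<close>

lemma surjective_image_vectorspace:
  fixes M :: "('k::field, 'v, 'm) module_scheme" and Q :: "('k, 'w, 'n) module_scheme"
  assumes M: "vectorspace class_ring M"
    and surj: "q ` carrier M = carrier Q"
    and add: "\<And>v w. \<lbrakk>v \<in> carrier M; w \<in> carrier M\<rbrakk> \<Longrightarrow> q (v \<oplus>\<^bsub>M\<^esub> w) = q v \<oplus>\<^bsub>Q\<^esub> q w"
    and smult: "\<And>c v. v \<in> carrier M \<Longrightarrow> q (c \<odot>\<^bsub>M\<^esub> v) = c \<odot>\<^bsub>Q\<^esub> q v"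
    and zero: "q \<zero>\<^bsub>M\<^esub> = \<zero>\<^bsub>Q\<^esub>"
  shows "vectorspace class_ring Q" "q \<in> LinearCombinations.module_hom class_ring M Q"
proof -
  interpret M: kspace M using M by (simp add: kspace_def)
  have rep: "\<exists>v\<in>carrier M. X = q v" if "X \<in> carrier Q" for X using that surj by blast
  have qin [simp]: "q v \<in> carrier Q" if "v \<in> carrier M" for v using that surj by blast
  note eqs = add[symmetric] smult[symmetric] zero[symmetric]
  show "vectorspace class_ring Q"
  proof (intro vectorspace.intro moduleI abelian_groupI)
    show "\<exists>Y\<in>carrier Q. Y \<oplus>\<^bsub>Q\<^esub> X = \<zero>\<^bsub>Q\<^esub>" if X: "X \<in> carrier Q" for X
    proof -
      obtain v where v: "v \<in> carrier M" "X = q v" using rep[OF X] by blast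
      then have "q (\<ominus>\<^bsub>M\<^esub> v) \<oplus>\<^bsub>Q\<^esub> X = \<zero>\<^bsub>Q\<^esub>"
        by (simp add: eqs M.M.l_neg)
      then show ?thesis using v(1) by (intro bexI[of _ "q (\<ominus>\<^bsub>M\<^esub> v)"]) auto
    qed
    show "cring (class_ring :: 'k ring)" "Ring.field (class_ring :: 'k ring)" by intro_locales
  qed (auto dest!: rep simp: eqs M.smult_add_left M.smult_add_right M.smult_smult M.M.a_ac)
  show "q \<in> LinearCombinations.module_hom class_ring M Q"
    using add smult by (auto simp: LinearCombinations.module_hom_def)
qed

lemma surjective_image_lie_module:
  fixes L :: "('k::field, 'g) lie_algebra"
    and M :: "('k, 'g, 'v) lie_module" and Q :: "('k, 'g, 'w) lie_module"
  assumes M: "lie_module L M"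
    and surj: "q ` carrier M = carrier Q"
    and add: "\<And>v w. \<lbrakk>v \<in> carrier M; w \<in> carrier M\<rbrakk> \<Longrightarrow> q (v \<oplus>\<^bsub>M\<^esub> w) = q v \<oplus>\<^bsub>Q\<^esub> q w"
    and smult: "\<And>c v. v \<in> carrier M \<Longrightarrow> q (c \<odot>\<^bsub>M\<^esub> v) = c \<odot>\<^bsub>Q\<^esub> q v"
    and zero: "q \<zero>\<^bsub>M\<^esub> = \<zero>\<^bsub>Q\<^esub>"
    and act: "\<And>x v. \<lbrakk>x \<in> carrier L; v \<in> carrier M\<rbrakk> \<Longrightarrow> q (act M x v) = act Q x (q v)"
  shows "lie_module L Q"
proof -
  interpret M: lie_module L M by fact
  note Q = surjective_image_vectorspace[OF M.M.vectorspace_axioms surj add smult zero]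
  interpret Q: kspace Q using Q(1) by (simp add: kspace_def)
  interpret q: mod_hom class_ring M Q q
    by (intro mod_hom.intro mod_hom_axioms.intro M.M.module_axioms Q.module_axioms Q(2))
  have rep: "\<exists>v\<in>carrier M. X = q v" if "X \<in> carrier Q" for X using that surj by blast
  have qin [simp]: "q v \<in> carrier Q" if "v \<in> carrier M" for v using that surj by blast
  have minus: "q v \<ominus>\<^bsub>Q\<^esub> q w = q (v \<ominus>\<^bsub>M\<^esub> w)" if "v \<in> carrier M" "w \<in> carrier M" for v w
    using q.f_minus that by simp
  note eqs = add[symmetric] smult[symmetric] act[symmetric] minus
  show ?thesis
    by (intro lie_module.intro lie_module_axioms.intro M.L.lie_algebra_axioms Q(1))
      (auto dest!: rep simp: eqs M.act_closed M.act_add_left M.act_add_right M.act_smult_left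
        M.act_smult_right M.act_bracket M.L.bracket_closed simp del: q.f_add q.f_minus q.f_smult)
qed

context kspace
begin

lemma submodule_abelian_subgroup:
  assumes "submodule class_ring N V"
  shows "abelian_subgroup N V"
proof (rule abelian_subgroupI3)
  interpret N: submodule class_ring N V by fact
  have "N \<noteq> {}" using N.zero_closed by blast
  then show "additive_subgroup N V"
    using N.subset submodule_neg[OF assms]
    by (intro additive_subgroup.intro M.add.subgroupI) (auto simp: a_inv_def)
  show "abelian_group V" by (rule M.abelian_group_axioms)
qed

lemma coset_mem_iff:
  assumes N: "submodule class_ring N V" and v: "v \<in> carrier V"
  shows "w \<in> N +> v \<longleftrightarrow> w \<in> carrier V \<and> w \<ominus> v \<in> N"
proof -
  interpret N: abelian_subgroup N V using submodule_abelian_subgroup[OF N] .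
  have "N +> v \<subseteq> carrier V" using M.a_r_coset_subset_G N.a_subset v by blast
  then show ?thesis using N.a_rcos_module[OF v] by (auto simp: M.minus_eq)
qed

lemma coset_eq_iff:
  assumes N: "submodule class_ring N V" and v: "v \<in> carrier V" and w: "w \<in> carrier V"
  shows "N +> v = N +> w \<longleftrightarrow> v \<ominus> w \<in> N"
proof -
  interpret N: abelian_subgroup N V using submodule_abelian_subgroup[OF N] .
  show ?thesis
    using coset_mem_iff[OF N w, of v] N.a_rcos_self[OF v] N.a_repr_independence'[OF _ w] v by auto
qed

lemma coset_self: "\<lbrakk>submodule class_ring N V; v \<in> carrier V\<rbrakk> \<Longrightarrow> v \<in> N +> v"
  using abelian_subgroup.a_rcos_self[OF submodule_abelian_subgroup] .

lemma coset_zero: "submodule class_ring N V \<Longrightarrow> N +> \<zero> = N"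
  by (simp add: submodule.subset)

lemma coset_add:
  assumes "submodule class_ring N V" "v \<in> carrier V" "w \<in> carrier V"
  shows "set_add V (N +> v) (N +> w) = N +> (v \<oplus> w)"
  using abelian_subgroup.a_rcos_sum[OF submodule_abelian_subgroup] assms by blast

text \<open>
The operations of a quotient are unions over representatives; they take the expected value on cosets as
soon as \<open>g\<close> respects congruence modulo \<open>N\<close>.
\<close>

lemma coset_UNION:
  assumes N: "submodule class_ring N V" and v: "v \<in> carrier V"
    and g: "\<And>w. w \<in> carrier V \<Longrightarrow> g w \<in> carrier V"
    and gN: "\<And>w w'. \<lbrakk>w \<in> carrier V; w' \<in> carrier V; w \<ominus> w' \<in> N\<rbrakk> \<Longrightarrow> g w \<ominus> g w' \<in> N"
  shows "(\<Union>w\<in>N +> v. N +> g w) = N +> g v"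
proof -
  have "N +> g w = N +> g v" if w: "w \<in> N +> v" for w
  proof -
    have "w \<in> carrier V" "w \<ominus> v \<in> N" using coset_mem_iff[OF N v] w by auto
    then show ?thesis using gN[OF _ v] v g coset_eq_iff[OF N] by simp
  qed
  then show ?thesis using coset_self[OF N v] by blast
qed

end

lemma quotient_module_simps:
  "carrier (quotient_module M N) = a_rcosets\<^bsub>M\<^esub> N"
  "zero (quotient_module M N) = N"
  "add (quotient_module M N) = set_add M"
  "smult (quotient_module M N) = (\<lambda>c X. \<Union>v\<in>X. N +>\<^bsub>M\<^esub> (c \<odot>\<^bsub>M\<^esub> v))"
  "act (quotient_module M N) = (\<lambda>x X. \<Union>v\<in>X. N +>\<^bsub>M\<^esub> (act M x v))"
  by (simp_all add: quotient_module_def quotient_space_def module.defs lie_module.defs)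

context lie_module
begin

context
  fixes N
  assumes N: "lie_submodule L N M"
begin

lemma N_submodule: "submodule class_ring N M"
  using N by (simp add: lie_submodule_def)

lemma quotient_module_ops:
  "(\<lambda>v. N +>\<^bsub>M\<^esub> v) ` carrier M = carrier (quotient_module M N)"
  "\<lbrakk>v \<in> carrier M; w \<in> carrier M\<rbrakk> \<Longrightarrow>
    N +>\<^bsub>M\<^esub> (v \<oplus>\<^bsub>M\<^esub> w) = (N +>\<^bsub>M\<^esub> v) \<oplus>\<^bsub>quotient_module M N\<^esub> (N +>\<^bsub>M\<^esub> w)"
  "v \<in> carrier M \<Longrightarrow> N +>\<^bsub>M\<^esub> (c \<odot>\<^bsub>M\<^esub> v) = c \<odot>\<^bsub>quotient_module M N\<^esub> (N +>\<^bsub>M\<^esub> v)"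
  "N +>\<^bsub>M\<^esub> \<zero>\<^bsub>M\<^esub> = \<zero>\<^bsub>quotient_module M N\<^esub>"
  "\<lbrakk>x \<in> carrier L; v \<in> carrier M\<rbrakk> \<Longrightarrow>
    N +>\<^bsub>M\<^esub> act M x v = act (quotient_module M N) x (N +>\<^bsub>M\<^esub> v)"
proof -
  show "(\<lambda>v. N +>\<^bsub>M\<^esub> v) ` carrier M = carrier (quotient_module M N)"
    by (auto simp: quotient_module_simps A_RCOSETS_def')
  show "N +>\<^bsub>M\<^esub> (v \<oplus>\<^bsub>M\<^esub> w) = (N +>\<^bsub>M\<^esub> v) \<oplus>\<^bsub>quotient_module M N\<^esub> (N +>\<^bsub>M\<^esub> w)"
    if "v \<in> carrier M" "w \<in> carrier M"
    using M.coset_add[OF N_submodule that] by (simp add: quotient_module_simps)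
  show "N +>\<^bsub>M\<^esub> (c \<odot>\<^bsub>M\<^esub> v) = c \<odot>\<^bsub>quotient_module M N\<^esub> (N +>\<^bsub>M\<^esub> v)"
    if v: "v \<in> carrier M"
  proof -
    have "c \<odot>\<^bsub>M\<^esub> w \<ominus>\<^bsub>M\<^esub> c \<odot>\<^bsub>M\<^esub> w' \<in> N"
      if "w \<in> carrier M" "w' \<in> carrier M" "w \<ominus>\<^bsub>M\<^esub> w' \<in> N" for w w'
      using submodule.smult_closed[OF N_submodule, of c "w \<ominus>\<^bsub>M\<^esub> w'"] that
      by (simp add: M.minus_eq M.smult_add_right M.smult_neg)
    then show ?thesis
      using M.coset_UNION[OF N_submodule v, of "\<lambda>v. c \<odot>\<^bsub>M\<^esub> v"]
      by (simp add: quotient_module_simps)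
  qed
  show "N +>\<^bsub>M\<^esub> \<zero>\<^bsub>M\<^esub> = \<zero>\<^bsub>quotient_module M N\<^esub>"
    using M.coset_zero[OF N_submodule] by (simp add: quotient_module_simps)
  show "N +>\<^bsub>M\<^esub> act M x v = act (quotient_module M N) x (N +>\<^bsub>M\<^esub> v)"
    if x: "x \<in> carrier L" and v: "v \<in> carrier M"
  proof -
    have "act M x w \<ominus>\<^bsub>M\<^esub> act M x w' \<in> N"
      if w: "w \<in> carrier M" "w' \<in> carrier M" "w \<ominus>\<^bsub>M\<^esub> w' \<in> N" for w w'
    proof -
      have "act M x w \<ominus>\<^bsub>M\<^esub> act M x w' = act M x (w \<ominus>\<^bsub>M\<^esub> w')"
        using M.linop_minus[OF act_linop[OF x] w(1,2)] by simp
      then show ?thesis using w(3) x N by (auto simp: lie_submodule_def)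
    qed
    then show ?thesis
      using M.coset_UNION[OF N_submodule v, of "act M x"] act_closed[OF x]
      by (simp add: quotient_module_simps)
  qed
qed

lemma quotient_lie_module: "lie_module L (quotient_module M N)"
  by (rule surjective_image_lie_module[OF lie_module_axioms quotient_module_ops])

lemma quotient_map_hom:
  "(\<lambda>v. N +>\<^bsub>M\<^esub> v) \<in> LinearCombinations.module_hom class_ring M (quotient_module M N)"
  by (rule surjective_image_vectorspace(2)[OF M.vectorspace_axioms quotient_module_ops(1-4)])

lemma quotient_fin_dim:
  assumes "M.fin_dim"
  shows "vectorspace.fin_dim class_ring (quotient_module M N)"
proof -
  interpret Q: lie_module L "quotient_module M N" by (rule quotient_lie_module)
  interpret linear_map class_ring M "quotient_module M N" "\<lambda>v. N +>\<^bsub>M\<^esub> v"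
    by (intro linear_map.intro mod_hom.intro mod_hom_axioms.intro M.vectorspace_axioms
        Q.M.vectorspace_axioms M.module_axioms Q.M.module_axioms quotient_map_hom)
  show ?thesis using surj_fin_dim[OF assms] quotient_module_ops(1) by simp
qed

text \<open>
The preimage of a submodule of the quotient lies between \<open>N\<close> and \<open>M\<close>.
\<close>

lemma quotient_irreducible:
  assumes ne: "N \<noteq> carrier M"
    and max: "\<And>P. \<lbrakk>lie_submodule L P M; N \<subseteq> P\<rbrakk> \<Longrightarrow> P = N \<or> P = carrier M"
  shows "irreducible_lie_module L (quotient_module M N)"
proof -
  let ?Q = "quotient_module M N"
  let ?q = "\<lambda>v. N +>\<^bsub>M\<^esub> v"
  interpret Q: lie_module L ?Q by (rule quotient_lie_module)
  have q_zero: "?q v = \<zero>\<^bsub>?Q\<^esub> \<longleftrightarrow> v \<in> N" if "v \<in> carrier M" for v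
    using M.coset_eq_iff[OF N_submodule that M.M.zero_closed] that
    by (simp add: quotient_module_ops(4)[symmetric])
  show ?thesis unfolding irreducible_lie_module_def
  proof (intro conjI allI impI)
    obtain v where v: "v \<in> carrier M" "v \<notin> N"
      using ne submodule.subset[OF N_submodule] by blast
    then have "?q v \<in> carrier ?Q" "?q v \<noteq> \<zero>\<^bsub>?Q\<^esub>"
      using q_zero[OF v(1)] unfolding quotient_module_ops(1)[symmetric] by auto
    then show "carrier ?Q \<noteq> {\<zero>\<^bsub>?Q\<^esub>}" by force
    fix R
    assume R: "lie_submodule L R ?Q"
    then interpret R: submodule class_ring R ?Q by (simp add: lie_submodule_def)
    let ?P = "{v \<in> carrier M. ?q v \<in> R}"
    have "R \<subseteq> ?q ` carrier M" using R.subset by (simp only: quotient_module_ops(1))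
    then have R_eq: "R = ?q ` ?P" by blast
    have "lie_submodule L ?P M"
      unfolding lie_submodule_def
    proof (intro conjI ballI lie_module_axioms M.submoduleI)
      show "\<zero>\<^bsub>M\<^esub> \<in> ?P" using R.zero_closed quotient_module_ops(4) by simp
      show "v \<oplus>\<^bsub>M\<^esub> w \<in> ?P" if "v \<in> ?P" "w \<in> ?P" for v w
        using that quotient_module_ops(2) by simp
      show "c \<odot>\<^bsub>M\<^esub> v \<in> ?P" if "v \<in> ?P" for c v
        using that quotient_module_ops(3) by simp
      show "act M x v \<in> ?P" if "x \<in> carrier L" "v \<in> ?P" for x v
        using that quotient_module_ops(5) R act_closed by (auto simp: lie_submodule_def)
    qed auto
    moreover have "N \<subseteq> ?P"
    proof
      fix v assume "v \<in> N"
      moreover from this have "v \<in> carrier M" using submodule.subset[OF N_submodule] by blast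
      ultimately have "?q v = \<zero>\<^bsub>?Q\<^esub>" using q_zero by blast
      then show "v \<in> ?P" using R.zero_closed \<open>v \<in> carrier M\<close> by simp
    qed
    ultimately consider "?P = N" | "?P = carrier M" using max by blast
    then show "R = {\<zero>\<^bsub>?Q\<^esub>} \<or> R = carrier ?Q"
    proof cases
      case 1
      then have "R \<subseteq> {\<zero>\<^bsub>?Q\<^esub>}" using R_eq q_zero by blast
      then show ?thesis using R.zero_closed by blast
    next
      case 2
      then show ?thesis using R_eq quotient_module_ops(1) by simp
    qed
  qed (rule quotient_lie_module)
qed

end

lemma zero_lie_submodule: "lie_submodule L {\<zero>\<^bsub>M\<^esub>} M"
  using lie_module_axioms act_linop[THEN M.linop_zero]
  by (auto simp: lie_submodule_def intro!: M.submoduleI)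

lemma carrier_lie_submodule: "lie_submodule L (carrier M) M"
  using lie_module_axioms act_closed by (auto simp: lie_submodule_def intro!: M.submoduleI)

lemma restrict_lie_module:
  assumes P: "lie_submodule L P M"
  shows "lie_module L (M\<lparr>carrier := P\<rparr>)"
proof -
  interpret P: submodule class_ring P M using P by (simp add: lie_submodule_def)
  have PM: "v \<in> carrier M" if "v \<in> P" for v using that P.subset by blast
  have vs: "vectorspace class_ring (M\<lparr>carrier := P\<rparr>)"
    by (intro vectorspace.intro M.submodule_is_module P.submodule_axioms) intro_locales
  interpret P: kspace "M\<lparr>carrier := P\<rparr>" using vs by (simp add: kspace_def)
  have minus: "v \<ominus>\<^bsub>M\<lparr>carrier := P\<rparr>\<^esub> w = v \<ominus>\<^bsub>M\<^esub> w" if "v \<in> P" "w \<in> P" for v w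
    using P.neg_smult[of w 1] M.neg_smult[of w 1] PM that by (simp add: a_minus_def)
  have act: "act M x v \<in> P" if "x \<in> carrier L" "v \<in> P" for x v
    using P that by (simp add: lie_submodule_def)
  show ?thesis
    by (intro lie_module.intro lie_module_axioms.intro L.lie_algebra_axioms vs)
      (simp_all add: act minus PM act_add_left act_add_right act_smult_left act_smult_right
        act_bracket)
qed

text \<open>
Composition factors are quotients of modules with a shrunken carrier; this moves their submodules back
to the ambient module.
\<close>

lemma restrict_lie_submodule_iff:
  assumes P: "lie_submodule L P M"
  shows "lie_submodule L R (M\<lparr>carrier := P\<rparr>) \<longleftrightarrow> lie_submodule L R M \<and> R \<subseteq> P"
proof -
  interpret P: lie_module L "M\<lparr>carrier := P\<rparr>" by (rule restrict_lie_module[OF P])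
  have "P \<subseteq> carrier M" using P by (auto simp: lie_submodule_def submodule_def)
  then show ?thesis
    using M.module_axioms P.M.module_axioms P lie_module_axioms P.lie_module_axioms
    unfolding lie_submodule_def submodule_def by auto
qed

end

lemma lie_submoduleD:
  assumes "lie_submodule L P M"
  shows "lie_module L M" "submodule class_ring P M" "P \<subseteq> carrier M"
    "\<And>x v. \<lbrakk>x \<in> carrier L; v \<in> P\<rbrakk> \<Longrightarrow> act M x v \<in> P"
  using assms submodule.subset unfolding lie_submodule_def by blast+

text \<open>
The setting of the isomorphism theorem.  The domain may be a submodule with its carrier shrunk, which is
how factors of a series present themselves.
\<close>

locale lie_epimorphism = M: lie_module L M + V: lie_module L V
  for L :: "('k::field, 'g) lie_algebra"
    and M :: "('k, 'g, 'v) lie_module" and V :: "('k, 'g, 'w) lie_module" +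
  fixes f :: "'v \<Rightarrow> 'w"
  assumes hom: "f \<in> LinearCombinations.module_hom class_ring M V"
    and equivariant: "\<And>x v. \<lbrakk>x \<in> carrier L; v \<in> carrier M\<rbrakk> \<Longrightarrow> f (act M x v) = act V x (f v)"
    and surj: "f ` carrier M = carrier V"
begin

sublocale mod_hom class_ring M V f
  by (intro mod_hom.intro mod_hom_axioms.intro M.M.module_axioms V.M.module_axioms hom)

abbreviation "Ker \<equiv> {v \<in> carrier M. f v = \<zero>\<^bsub>V\<^esub>}"

lemma kernel_lie_submodule: "lie_submodule L Ker M"
  using ker_is_submodule M.lie_module_axioms V.act_linop[THEN V.M.linop_zero]
  by (auto simp: lie_submodule_def ker_def equivariant M.act_closed)

lemma diff_in_kernel_iff:
  assumes "v \<in> carrier M" "w \<in> carrier M"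
  shows "v \<ominus>\<^bsub>M\<^esub> w \<in> Ker \<longleftrightarrow> f v = f w"
proof -
  have "f v \<ominus>\<^bsub>V\<^esub> f w = \<zero>\<^bsub>V\<^esub> \<longleftrightarrow> f v = f w"
    using assms by (intro V.M.minus_eq_zero_iff) auto
  then show ?thesis using assms by simp
qed

text \<open>
Since the elements of the quotient are sets, the isomorphism \<open>V \<rightarrow> M / ker f\<close> is simply the map that sends
a vector to its fibre under \<open>f\<close>.
\<close>

lemma isomorphic_quotient: "lie_module_isomorphic L V (quotient_module M Ker)"
proof -
  let ?Q = "quotient_module M Ker" and ?g = "\<lambda>w. {v \<in> carrier M. f v = w}"
  let ?q = "\<lambda>v. Ker +>\<^bsub>M\<^esub> v"
  note ops = M.quotient_module_ops[OF kernel_lie_submodule]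
  note sub = lie_submoduleD(2)[OF kernel_lie_submodule]
  interpret Q: lie_module L ?Q by (rule M.quotient_lie_module[OF kernel_lie_submodule])
  have g: "?g (f v) = ?q v" if v: "v \<in> carrier M" for v
    using M.M.coset_mem_iff[OF sub v] diff_in_kernel_iff[OF _ v] by blast
  have q_in: "?q v \<in> carrier ?Q" if "v \<in> carrier M" for v using ops(1) that by blast
  have rep: "\<exists>v\<in>carrier M. w = f v" if "w \<in> carrier V" for w using surj that by blast
  have "?g \<in> LinearCombinations.module_hom class_ring V ?Q"
    unfolding LinearCombinations.module_hom_def
  proof (intro CollectI conjI allI impI Pi_I)
    fix w assume "w \<in> carrier V"
    then obtain v where v: "v \<in> carrier M" "w = f v" using rep by blast
    show "?g w \<in> carrier ?Q" using q_in[OF v(1)] by (simp only: v(2) g[OF v(1)])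
  next
    fix w w' assume w: "w \<in> carrier V \<and> w' \<in> carrier V"
    obtain v v' where v: "v \<in> carrier M" "v' \<in> carrier M" "w = f v" "w' = f v'"
      using rep[of w] rep[of w'] w by auto
    have "?g (f (v \<oplus>\<^bsub>M\<^esub> v')) = ?g (f v) \<oplus>\<^bsub>?Q\<^esub> ?g (f v')"
      using ops(2)[OF v(1,2)] by (simp only: g[OF v(1)] g[OF v(2)] g[OF M.M.M.a_closed[OF v(1,2)]])
    then show "?g (w \<oplus>\<^bsub>V\<^esub> w') = ?g w \<oplus>\<^bsub>?Q\<^esub> ?g w'" using v by simp
  next
    fix c :: 'k and w assume "c \<in> carrier class_ring \<and> w \<in> carrier V"
    then obtain v where v: "v \<in> carrier M" "w = f v" using rep by blast
    then have "?g (f (c \<odot>\<^bsub>M\<^esub> v)) = c \<odot>\<^bsub>?Q\<^esub> ?g (f v)"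
      using g ops(3) M.M.smult_in by presburger
    then show "?g (c \<odot>\<^bsub>V\<^esub> w) = c \<odot>\<^bsub>?Q\<^esub> ?g w" using v by simp
  qed
  moreover have "bij_betw ?g (carrier V) (carrier ?Q)"
    unfolding bij_betw_def
  proof
    show "inj_on ?g (carrier V)" using rep by (intro inj_onI) blast
    have "?g ` carrier V = (\<lambda>v. ?g (f v)) ` carrier M" unfolding surj[symmetric] by blast
    also have "\<dots> = ?q ` carrier M" using g by (intro image_cong) auto
    finally show "?g ` carrier V = carrier ?Q" using ops(1) by simp
  qed
  moreover have "?g (act V x w) = act ?Q x (?g w)" if x: "x \<in> carrier L" and w: "w \<in> carrier V" for x w
  proof -
    obtain v where v: "v \<in> carrier M" "w = f v" using rep w by blast
    then have "?g (f (act M x v)) = act ?Q x (?g (f v))"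
      using g ops(5) x M.act_closed by presburger
    then show ?thesis using v x by (simp add: equivariant)
  qed
  ultimately show ?thesis
    unfolding lie_module_isomorphic_def using V.lie_module_axioms Q.lie_module_axioms by blast
qed

text \<open>
A submodule above the kernel is determined by its image in \<open>V\<close>, which is zero or everything.
\<close>

lemma kernel_quotient_irreducible:
  assumes irr: "irreducible_lie_module L V"
  shows "irreducible_lie_module L (quotient_module M Ker)"
proof (rule M.quotient_irreducible[OF kernel_lie_submodule])
  show "Ker \<noteq> carrier M"
  proof
    assume "Ker = carrier M"
    then have "f v = \<zero>\<^bsub>V\<^esub>" if "v \<in> carrier M" for v using that by blast
    then have "f ` carrier M \<subseteq> {\<zero>\<^bsub>V\<^esub>}" by auto
    then have "carrier V \<subseteq> {\<zero>\<^bsub>V\<^esub>}" by (simp only: surj)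
    then have "carrier V = {\<zero>\<^bsub>V\<^esub>}" using V.M.M.zero_closed by blast
    then show False using irr by (simp add: irreducible_lie_module_def)
  qed
  fix P
  assume P: "lie_submodule L P M" "Ker \<subseteq> P"
  note PD = lie_submoduleD[OF P(1)]
  interpret P: submodule class_ring P M by (rule PD(2))
  have "lie_submodule L (f ` P) V"
    unfolding lie_submodule_def
  proof (intro conjI ballI V.lie_module_axioms V.M.submoduleI)
    show "f ` P \<subseteq> carrier V" using PD(3) by auto
    show "\<zero>\<^bsub>V\<^esub> \<in> f ` P" using P.zero_closed f0_is_0 by (metis imageI)
    show "v \<oplus>\<^bsub>V\<^esub> w \<in> f ` P" if vw: "v \<in> f ` P" "w \<in> f ` P" for v w
    proof -
      obtain a b where ab: "a \<in> P" "b \<in> P" "v = f a" "w = f b" using vw by blast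
      then have "v \<oplus>\<^bsub>V\<^esub> w = f (a \<oplus>\<^bsub>M\<^esub> b)" using PD(3) by (simp add: subset_iff)
      then show ?thesis using ab by simp
    qed
    show "c \<odot>\<^bsub>V\<^esub> v \<in> f ` P" if v: "v \<in> f ` P" for c v
    proof -
      obtain a where a: "a \<in> P" "v = f a" using v by blast
      then have "c \<odot>\<^bsub>V\<^esub> v = f (c \<odot>\<^bsub>M\<^esub> a)" using PD(3) by (simp add: subset_iff)
      then show ?thesis using a by simp
    qed
    show "act V x v \<in> f ` P" if x: "x \<in> carrier L" and v: "v \<in> f ` P" for x v
    proof -
      obtain a where a: "a \<in> P" "v = f a" using v by blast
      then have "act V x v = f (act M x a)" using PD(3) x by (auto simp: equivariant)
      then show ?thesis using a PD(4)[OF x] by simp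
    qed
  qed
  then consider "f ` P = {\<zero>\<^bsub>V\<^esub>}" | "f ` P = carrier V"
    using irr unfolding irreducible_lie_module_def by blast
  then show "P = Ker \<or> P = carrier M"
  proof cases
    case 1
    then show ?thesis using P(2) PD(3) by blast
  next
    case 2
    have "v \<in> P" if v: "v \<in> carrier M" for v
    proof -
      have "f v \<in> f ` P" using 2 v by simp
      then obtain p where p: "p \<in> P" "f v = f p" by blast
      then have pM: "p \<in> carrier M" using PD(3) by blast
      then have "v \<ominus>\<^bsub>M\<^esub> p \<in> P" using diff_in_kernel_iff[OF v pM] p(2) P(2) by blast
      then have "(v \<ominus>\<^bsub>M\<^esub> p) \<oplus>\<^bsub>M\<^esub> p \<in> P" using p(1) by simp
      then show ?thesis using v pM by (simp add: M.M.minus_eq M.M.M.a_assoc M.M.M.l_neg)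
    qed
    then show ?thesis using PD(3) by blast
  qed
qed

end

section \<open>Composition series\<close>

definition irreducible_step ::
    "('k::field, 'g) lie_algebra \<Rightarrow> ('k, 'g, 'v) lie_module \<Rightarrow> 'v set \<Rightarrow> 'v set \<Rightarrow> bool" where
  "irreducible_step L W P Q \<longleftrightarrow>
    P \<subseteq> Q \<and> irreducible_lie_module L (quotient_module (W\<lparr>carrier := Q\<rparr>) P)"

text \<open>
A composition series between two arbitrary submodules, so that series can be concatenated.
\<close>

definition refined_chain ::
    "('k::field, 'g) lie_algebra \<Rightarrow> ('k, 'g, 'v) lie_module \<Rightarrow> 'v set list \<Rightarrow> bool" where
  "refined_chain L W Ns \<longleftrightarrow>
    Ns \<noteq> [] \<and> (\<forall>N\<in>set Ns. lie_submodule L N W) \<and> successively (irreducible_step L W) Ns"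

text \<open>
Each step goes from \<open>P\<close> to a minimal submodule \<open>R\<close> strictly above \<open>P\<close> and inside \<open>Q\<close>, which makes \<open>R / P\<close>
irreducible; the measure of subspaces bounds the number of steps.
\<close>

lemma (in lie_module) refined_chain_exists:
  assumes fd: "M.fin_dim" and P: "lie_submodule L P M" and Q: "lie_submodule L Q M" and PQ: "P \<subseteq> Q"
  obtains Ns where "refined_chain L M Ns" "hd Ns = P" "last Ns = Q"
proof -
  obtain \<mu> :: "'v set \<Rightarrow> nat" and b where
    \<mu>: "\<And>P Q. \<lbrakk>submodule class_ring P M; submodule class_ring Q M; P \<subset> Q\<rbrakk> \<Longrightarrow> \<mu> P < \<mu> Q"
    and b: "\<And>P. submodule class_ring P M \<Longrightarrow> \<mu> P \<le> b"
    using M.subspace_measure[OF fd] by metis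
  have "\<exists>Ns. refined_chain L M Ns \<and> hd Ns = P \<and> last Ns = Q"
    using P PQ
  proof (induction "b - \<mu> P" arbitrary: P rule: less_induct)
    case less
    show ?case
    proof (cases "P = Q")
      case True
      then show ?thesis
        using Q by (intro exI[of _ "[Q]"]) (simp add: refined_chain_def)
    next
      case False
      let ?\<Phi> = "\<lambda>R. lie_submodule L R M \<and> P \<subset> R \<and> R \<subseteq> Q"
      have Q': "?\<Phi> Q" using False Q less.prems(2) by blast
      have sub: "submodule class_ring R M" if "?\<Phi> R" for R
        using lie_submoduleD(2) that by blast
      obtain R where R: "?\<Phi> R" and min: "\<And>R'. \<lbrakk>?\<Phi> R'; R' \<subseteq> R\<rbrakk> \<Longrightarrow> R' = R"
      proof (rule M.minimal_subspace[of ?\<Phi> Q, OF fd sub Q'])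
        fix R assume "?\<Phi> R" "\<And>R'. \<lbrakk>?\<Phi> R'; R' \<subseteq> R\<rbrakk> \<Longrightarrow> R' = R"
        then show thesis by (rule that)
      qed
      then have RM: "lie_submodule L R M" and PR: "P \<subset> R" and RQ: "R \<subseteq> Q" by auto
      interpret R: lie_module L "M\<lparr>carrier := R\<rparr>" by (rule restrict_lie_module[OF RM])
      note sub_iff = restrict_lie_submodule_iff[OF RM]
      have "irreducible_lie_module L (quotient_module (M\<lparr>carrier := R\<rparr>) P)"
      proof (rule R.quotient_irreducible)
        show "lie_submodule L P (M\<lparr>carrier := R\<rparr>)" using sub_iff less.prems(1) PR by blast
        show "P \<noteq> carrier (M\<lparr>carrier := R\<rparr>)" using PR by simp
        show "S = P \<or> S = carrier (M\<lparr>carrier := R\<rparr>)"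
          if S: "lie_submodule L S (M\<lparr>carrier := R\<rparr>)" "P \<subseteq> S" for S
        proof -
          have "lie_submodule L S M" "S \<subseteq> R" using sub_iff S(1) by blast+
          then show ?thesis using min[of S] S(2) RQ by auto
        qed
      qed
      then have step: "irreducible_step L M P R" using PR by (auto simp: irreducible_step_def)
      have "\<mu> P < \<mu> R" "\<mu> R \<le> b"
        using \<mu> b PR lie_submoduleD(2)[OF less.prems(1)] lie_submoduleD(2)[OF RM] by blast+
      then have "b - \<mu> R < b - \<mu> P" by linarith
      then obtain Ns where Ns: "refined_chain L M Ns" "hd Ns = R" "last Ns = Q"
        using less.hyps RM RQ by blast
      then have "refined_chain L M (P # Ns)"
        using step less.prems(1) by (cases Ns) (auto simp: refined_chain_def)
      moreover have "last (P # Ns) = Q" using Ns by (auto simp: refined_chain_def)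
      ultimately show ?thesis by (intro exI[of _ "P # Ns"]) simp
    qed
  qed
  then show ?thesis using that by blast
qed

text \<open>
A nonzero equivariant map from a submodule \<open>Q\<close> to an irreducible module \<open>V\<close> is onto, so \<open>Q\<close> modulo its
kernel \<open>K\<close> is isomorphic to \<open>V\<close>.  A chain from \<open>0\<close> to \<open>K\<close> followed by one from \<open>Q\<close> to \<open>M\<close> is a composition
series in which this factor occurs at the junction.
\<close>

lemma (in lie_module) irreducible_subquotient_is_composition_factor:
  fixes V :: "('k, 'g, 'w) lie_module"
  assumes fd: "M.fin_dim" and irr: "irreducible_lie_module L V"
    and Q: "lie_submodule L Q M"
    and f: "f \<in> LinearCombinations.module_hom class_ring (M\<lparr>carrier := Q\<rparr>) V"
    and equivariant: "\<And>x v. \<lbrakk>x \<in> carrier L; v \<in> Q\<rbrakk> \<Longrightarrow> f (act M x v) = act V x (f v)"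
    and nonzero: "u \<in> Q" "f u \<noteq> \<zero>\<^bsub>V\<^esub>"
  shows "V \<in> composition_factors L M"
proof -
  interpret Q: lie_module L "M\<lparr>carrier := Q\<rparr>" by (rule restrict_lie_module[OF Q])
  interpret V: lie_module L V using irr by (simp add: irreducible_lie_module_def)
  interpret f: mod_hom class_ring "M\<lparr>carrier := Q\<rparr>" V f
    by (intro mod_hom.intro mod_hom_axioms.intro Q.M.module_axioms V.M.module_axioms f)
  have "f ` Q = carrier V"
  proof (rule V.irreducibleD[OF irr])
    show "submodule class_ring (f ` Q) V" using f.im_is_submodule by (simp add: f.im_def)
    show "f ` Q \<noteq> {\<zero>\<^bsub>V\<^esub>}" using nonzero by blast
    show "act V x v \<in> f ` Q" if x: "x \<in> carrier L" and v: "v \<in> f ` Q" for x v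
    proof -
      obtain q where q: "q \<in> Q" "v = f q" using v by blast
      have "act V x v = f (act M x q)" using q equivariant[OF x q(1)] by simp
      then show ?thesis using lie_submoduleD(4)[OF Q x q(1)] by blast
    qed
  qed
  then interpret f: lie_epimorphism L "M\<lparr>carrier := Q\<rparr>" V f
    by unfold_locales (use f equivariant in auto)
  let ?K = "{v \<in> Q. f v = \<zero>\<^bsub>V\<^esub>}"
  have K: "lie_submodule L ?K M"
    using f.kernel_lie_submodule restrict_lie_submodule_iff[OF Q] by simp
  have step: "irreducible_step L M ?K Q"
    using f.kernel_quotient_irreducible[OF irr] by (auto simp: irreducible_step_def)
  have "\<zero>\<^bsub>M\<^esub> \<in> ?K" using submodule.zero_closed[OF lie_submoduleD(2)[OF K]] .
  then obtain Ns where Ns: "refined_chain L M Ns" "hd Ns = {\<zero>\<^bsub>M\<^esub>}" "last Ns = ?K"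
    using refined_chain_exists[OF fd zero_lie_submodule K] by blast
  obtain Ns' where Ns': "refined_chain L M Ns'" "hd Ns' = Q" "last Ns' = carrier M"
    using refined_chain_exists[OF fd Q carrier_lie_submodule lie_submoduleD(3)[OF Q]] by blast
  let ?Ns = "Ns @ Ns'" and ?i = "length Ns - 1"
  have ne: "Ns \<noteq> []" "Ns' \<noteq> []" using Ns(1) Ns'(1) by (auto simp: refined_chain_def)
  have chain: "successively (irreducible_step L M) ?Ns"
    using Ns Ns' step by (simp add: refined_chain_def successively_append_iff)
  have "composition_series L M ?Ns"
    unfolding composition_series_def
  proof (intro conjI allI impI lie_module_axioms)
    show "\<forall>N\<in>set ?Ns. lie_submodule L N M" using Ns(1) Ns'(1) by (auto simp: refined_chain_def)
    fix i assume "Suc i < length ?Ns"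
    then have "irreducible_step L M (?Ns ! i) (?Ns ! Suc i)"
      using chain by (simp add: successively_conv_nth)
    then show "?Ns ! i \<subseteq> ?Ns ! Suc i" "irreducible_lie_module L (series_factor M ?Ns i)"
      by (auto simp: irreducible_step_def series_factor_def)
  qed (use Ns Ns' ne in auto)
  moreover have "Suc ?i < length ?Ns" using ne by (cases Ns; cases Ns') auto
  moreover have "?Ns ! ?i = ?K"
    using ne Ns(3) by (simp add: nth_append last_conv_nth)
  moreover have "?Ns ! Suc ?i = Q"
    using ne Ns'(2) by (simp add: nth_append hd_conv_nth)
  moreover have "lie_module_isomorphic L V (quotient_module (M\<lparr>carrier := Q\<rparr>) ?K)"
    using f.isomorphic_quotient by simp
  ultimately have "lie_module_isomorphic L V (series_factor M ?Ns ?i)"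
    by (simp only: series_factor_def)
  with \<open>composition_series L M ?Ns\<close> \<open>Suc ?i < length ?Ns\<close> show ?thesis
    unfolding composition_factors_def by blast
qed

context lie_module
begin

text \<open>
The map \<open>f\<close> descends to the image of \<open>P\<close> in \<open>M / N\<close>: it is constant on the cosets of \<open>N\<close> inside \<open>P\<close>, and its
value there is the only element of the image of the coset.
\<close>

lemma irreducible_subquotient_of_quotient:
  fixes V :: "('k, 'g, 'w) lie_module"
  assumes fd: "M.fin_dim" and irr: "irreducible_lie_module L V"
    and N: "lie_submodule L N M" and P: "lie_submodule L P M" and NP: "N \<subseteq> P"
    and f: "f \<in> LinearCombinations.module_hom class_ring (M\<lparr>carrier := P\<rparr>) V"
    and equivariant: "\<And>x v. \<lbrakk>x \<in> carrier L; v \<in> P\<rbrakk> \<Longrightarrow> f (act M x v) = act V x (f v)"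
    and kills: "\<And>v. v \<in> N \<Longrightarrow> f v = \<zero>\<^bsub>V\<^esub>"
    and nonzero: "u \<in> P" "f u \<noteq> \<zero>\<^bsub>V\<^esub>"
  shows "V \<in> composition_factors L (quotient_module M N)"
proof -
  let ?W = "quotient_module M N" and ?q = "\<lambda>v. N +>\<^bsub>M\<^esub> v"
  let ?f = "\<lambda>X. the_elem (f ` X)"
  note ops = quotient_module_ops[OF N]
  note PD = lie_submoduleD[OF P]
  note ND = lie_submoduleD[OF N]
  interpret W: lie_module L ?W by (rule quotient_lie_module[OF N])
  interpret V: lie_module L V using irr by (simp add: irreducible_lie_module_def)
  interpret P: lie_module L "M\<lparr>carrier := P\<rparr>" by (rule restrict_lie_module[OF P])
  interpret f: mod_hom class_ring "M\<lparr>carrier := P\<rparr>" V f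
    by (intro mod_hom.intro mod_hom_axioms.intro P.M.module_axioms V.M.module_axioms f)
  interpret SP: submodule class_ring P M by (rule PD(2))
  have PM: "p \<in> carrier M" if "p \<in> P" for p using that PD(3) by blast
  have f_q: "?f (?q p) = f p" if p: "p \<in> P" for p
  proof -
    have "f w = f p" if w: "w \<in> ?q p" for w
    proof -
      have w': "w \<in> carrier M" "w \<ominus>\<^bsub>M\<^esub> p \<in> N"
        using M.coset_mem_iff[OF ND(2) PM[OF p]] w by auto
      have "f ((w \<ominus>\<^bsub>M\<^esub> p) \<oplus>\<^bsub>M\<^esub> p) = f (w \<ominus>\<^bsub>M\<^esub> p) \<oplus>\<^bsub>V\<^esub> f p"
        using f.f_add[of "w \<ominus>\<^bsub>M\<^esub> p" p] w'(2) NP p by (simp add: subset_iff)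
      also have "(w \<ominus>\<^bsub>M\<^esub> p) \<oplus>\<^bsub>M\<^esub> p = w"
        using w'(1) PM[OF p] by (simp add: M.minus_eq M.M.a_assoc M.M.l_neg)
      finally show ?thesis using kills[OF w'(2)] f.f_im[of p] p by simp
    qed
    then have "f ` ?q p = {f p}" using M.coset_self[OF ND(2) PM[OF p]] by blast
    then show ?thesis by simp
  qed
  have Q: "lie_submodule L (?q ` P) ?W"
    unfolding lie_submodule_def
  proof (intro conjI ballI W.lie_module_axioms W.M.submoduleI)
    show "?q ` P \<subseteq> carrier ?W" using ops(1) PD(3) by blast
    show "\<zero>\<^bsub>?W\<^esub> \<in> ?q ` P" using ops(4) SP.zero_closed by (metis imageI)
    show "X \<oplus>\<^bsub>?W\<^esub> Y \<in> ?q ` P" if X: "X \<in> ?q ` P" and Y: "Y \<in> ?q ` P" for X Y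
    proof -
      obtain p p' where p: "p \<in> P" "X = ?q p" "p' \<in> P" "Y = ?q p'" using X Y by blast
      have "X \<oplus>\<^bsub>?W\<^esub> Y = ?q (p \<oplus>\<^bsub>M\<^esub> p')" using ops(2) p PM by simp
      then show ?thesis using SP.m_closed[OF p(1,3)] by blast
    qed
    show "c \<odot>\<^bsub>?W\<^esub> X \<in> ?q ` P" if X: "X \<in> ?q ` P" for c X
    proof -
      obtain p where p: "p \<in> P" "X = ?q p" using X by blast
      have "c \<odot>\<^bsub>?W\<^esub> X = ?q (c \<odot>\<^bsub>M\<^esub> p)" using ops(3) p PM by simp
      then show ?thesis using SP.smult_closed[of c p] p(1) by simp
    qed
    show "act ?W x X \<in> ?q ` P" if x: "x \<in> carrier L" and X: "X \<in> ?q ` P" for x X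
    proof -
      obtain p where p: "p \<in> P" "X = ?q p" using X by blast
      have "act ?W x X = ?q (act M x p)" using ops(5)[OF x] p PM by simp
      then show ?thesis using PD(4)[OF x p(1)] by blast
    qed
  qed
  show ?thesis
  proof (rule W.irreducible_subquotient_is_composition_factor
      [OF quotient_fin_dim[OF N fd] irr Q, of ?f "?q u"])
    show "?f \<in> LinearCombinations.module_hom class_ring (?W\<lparr>carrier := ?q ` P\<rparr>) V"
      unfolding LinearCombinations.module_hom_def
    proof (intro CollectI conjI allI impI Pi_I)
      show "?f X \<in> carrier V" if "X \<in> carrier (?W\<lparr>carrier := ?q ` P\<rparr>)" for X
        using that f_q f.f_im by auto
    next
      fix X Y assume "X \<in> carrier (?W\<lparr>carrier := ?q ` P\<rparr>) \<and> Y \<in> carrier (?W\<lparr>carrier := ?q ` P\<rparr>)"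
      then obtain p p' where p: "p \<in> P" "X = ?q p" "p' \<in> P" "Y = ?q p'" by auto
      have "?f (X \<oplus>\<^bsub>?W\<^esub> Y) = ?f (?q (p \<oplus>\<^bsub>M\<^esub> p'))" using ops(2) p PM by simp
      also have "\<dots> = ?f X \<oplus>\<^bsub>V\<^esub> ?f Y"
        using f_q SP.m_closed p f.f_add[of p p'] by simp
      finally show "?f (X \<oplus>\<^bsub>?W\<lparr>carrier := ?q ` P\<rparr>\<^esub> Y) = ?f X \<oplus>\<^bsub>V\<^esub> ?f Y" by simp
    next
      fix c :: 'k and X assume "c \<in> carrier class_ring \<and> X \<in> carrier (?W\<lparr>carrier := ?q ` P\<rparr>)"
      then obtain p where p: "p \<in> P" "X = ?q p" by auto
      have "?f (c \<odot>\<^bsub>?W\<^esub> X) = ?f (?q (c \<odot>\<^bsub>M\<^esub> p))" using ops(3) p PM by simp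
      also have "\<dots> = c \<odot>\<^bsub>V\<^esub> ?f X"
        using f_q SP.smult_closed[of c p] p f.f_smult[of c p] by simp
      finally show "?f (c \<odot>\<^bsub>?W\<lparr>carrier := ?q ` P\<rparr>\<^esub> X) = c \<odot>\<^bsub>V\<^esub> ?f X" by simp
    qed
    show "?f (act ?W x X) = act V x (?f X)" if x: "x \<in> carrier L" and X: "X \<in> ?q ` P" for x X
    proof -
      obtain p where p: "p \<in> P" "X = ?q p" using X by blast
      have "act ?W x X = ?q (act M x p)" using ops(5)[OF x] p PM by simp
      then show ?thesis using f_q PD(4)[OF x p(1)] p equivariant[OF x p(1)] by simp
    qed
    show "?q u \<in> ?q ` P" "?f (?q u) \<noteq> \<zero>\<^bsub>V\<^esub>" using nonzero f_q by auto
  qed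
qed

end

section \<open>The adjoint module\<close>

lemma adjoint_module_simps [simp]:
  "carrier (adjoint_module L) = carrier L"
  "zero (adjoint_module L) = zero L"
  "add (adjoint_module L) = add L"
  "smult (adjoint_module L) = smult L"
  "act (adjoint_module L) = bracket L"
  by (simp_all add: adjoint_module_def module.defs lie_module.defs)

context lie_algebra
begin

lemma adjoint_vectorspace:
  "vectorspace class_ring (adjoint_module L)"
  "id \<in> LinearCombinations.module_hom class_ring L (adjoint_module L)"
  by (rule surjective_image_vectorspace[OF vectorspace_axioms]; simp)+

text \<open>
Subtraction is not an operation of the record but a description over its carrier and addition, so the
identity map has to transport it.
\<close>

lemma adjoint_minus:
  assumes "v \<in> carrier L" "w \<in> carrier L"
  shows "v \<ominus>\<^bsub>adjoint_module L\<^esub> w = v \<ominus>\<^bsub>L\<^esub> w"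
proof -
  interpret A: kspace "adjoint_module L" using adjoint_vectorspace by (simp add: kspace_def)
  interpret mod_hom class_ring L "adjoint_module L" id
    by (intro mod_hom.intro mod_hom_axioms.intro module_axioms A.module_axioms adjoint_vectorspace)
  show ?thesis using f_minus[OF assms] by simp
qed

text \<open>
The Jacobi identity as the statement that the adjoint action is an action.
\<close>

lemma bracket_bracket:
  assumes "x \<in> carrier L" "y \<in> carrier L" "v \<in> carrier L"
  shows "bracket L (bracket L x y) v = bracket L x (bracket L y v) \<ominus>\<^bsub>L\<^esub> bracket L y (bracket L x v)"
proof -
  note [simp] = assms bracket_closed
  have neg: "bracket L y (\<ominus>\<^bsub>L\<^esub> w) = \<ominus>\<^bsub>L\<^esub> bracket L y w" if "w \<in> carrier L" for w
    using linop_smult[OF bracket_linop[OF assms(2)] that, of "- 1"] that by (simp add: neg_smult)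
  have "bracket L y (bracket L v x) = \<ominus>\<^bsub>L\<^esub> bracket L y (bracket L x v)"
    using bracket_antisym[of x v] neg by simp
  then have "(bracket L x (bracket L y v) \<ominus>\<^bsub>L\<^esub> bracket L y (bracket L x v))
      \<oplus>\<^bsub>L\<^esub> bracket L v (bracket L x y) = \<zero>\<^bsub>L\<^esub>"
    using jacobi[OF assms] by (simp add: M.minus_eq)
  then have "bracket L v (bracket L x y)
      = \<ominus>\<^bsub>L\<^esub> (bracket L x (bracket L y v) \<ominus>\<^bsub>L\<^esub> bracket L y (bracket L x v))"
    by (subst (asm) add_eq_zero_iff) auto
  then show ?thesis using bracket_antisym[of v "bracket L x y"] by simp
qed

lemma adjoint_lie_module: "lie_module L (adjoint_module L)"
  by (intro lie_module.intro lie_module_axioms.intro lie_algebra_axioms adjoint_vectorspace(1))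
    (simp_all add: bracket_closed bracket_add_left bracket_add_right bracket_smult_left
      bracket_smult_right adjoint_minus bracket_bracket)

lemma derived_series_lie_submodule: "lie_submodule L (derived_series L n) (adjoint_module L)"
proof -
  interpret D: submodule class_ring "derived_series L n" L by (rule derived_series_submodule)
  interpret A: lie_module L "adjoint_module L" by (rule adjoint_lie_module)
  show ?thesis
    unfolding lie_submodule_def
    using D.subset derived_series_ideal A.lie_module_axioms
    by (auto intro!: A.M.submoduleI simp del: derived_series.simps)
qed

lemma adjoint_fin_dim:
  assumes "fin_dim"
  shows "vectorspace.fin_dim class_ring (adjoint_module L)"
proof -
  interpret A: lie_module L "adjoint_module L" by (rule adjoint_lie_module)
  interpret linear_map class_ring L "adjoint_module L" id
    by (intro linear_map.intro mod_hom.intro mod_hom_axioms.intro vectorspace_axioms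
        A.M.vectorspace_axioms module_axioms A.M.module_axioms adjoint_vectorspace(2))
  show ?thesis using surj_fin_dim[OF assms] by simp
qed

end

section \<open>Cocycles of degree 1\<close>

context lie_module
begin

lemma cocycle_hom: "z \<in> cocycles1 L M \<Longrightarrow> z \<in> LinearCombinations.module_hom class_ring L M"
  by (simp add: cocycles1_def cochains1_def)

lemma cocycle_extensional: "z \<in> cocycles1 L M \<Longrightarrow> z \<in> extensional (carrier L)"
  by (simp add: cocycles1_def cochains1_def)

lemma cocycle_in: "\<lbrakk>z \<in> cocycles1 L M; x \<in> carrier L\<rbrakk> \<Longrightarrow> z x \<in> carrier M"
  using module_hom_closed[OF cocycle_hom] by blast

lemma cocycle_bracket:
  assumes "z \<in> cocycles1 L M" "x \<in> carrier L" "y \<in> carrier L"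
  shows "z (bracket L x y) = act M x (z y) \<ominus>\<^bsub>M\<^esub> act M y (z x)"
proof -
  have "(act M x (z y) \<ominus>\<^bsub>M\<^esub> act M y (z x)) \<ominus>\<^bsub>M\<^esub> z (bracket L x y) = \<zero>\<^bsub>M\<^esub>"
    using assms by (simp add: cocycles1_def differential1_def)
  then show ?thesis
    using assms by (subst (asm) M.minus_eq_zero_iff) (auto simp: cocycle_in act_closed L.bracket_closed)
qed

text \<open>
If every cocycle is a coboundary, then each coset of the coboundaries is the space of coboundaries itself:
translating the coboundary of \<open>u\<close> by that of \<open>v\<close> gives the coboundary of \<open>u + v\<close>.
\<close>

lemma nonzero_cohomology1E:
  assumes "carrier (cohomology1 L M) \<noteq> {\<zero>\<^bsub>cohomology1 L M\<^esub>}"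
  obtains z where "z \<in> cocycles1 L M" "z \<notin> coboundaries1 L M"
proof -
  let ?C = "(cochains1 L M)\<lparr>carrier := cocycles1 L M\<rparr>"
  let ?B = "coboundaries1 L M"
  have zero: "(\<lambda>x\<in>carrier L. \<zero>\<^bsub>M\<^esub>) \<in> cocycles1 L M"
    using act_linop[THEN M.linop_zero]
    by (auto simp: cocycles1_def cochains1_def LinearCombinations.module_hom_def
        differential1_def L.bracket_closed)
  have coset: "?B +>\<^bsub>?C\<^esub> z = ?B" if z: "z \<in> ?B" for z
  proof -
    obtain v where v: "v \<in> carrier M" "z = (\<lambda>x\<in>carrier L. act M x v)"
      using z by (auto simp: coboundaries1_def differential0_def)
    have add: "differential0 L M u \<oplus>\<^bsub>?C\<^esub> z = differential0 L M (u \<oplus>\<^bsub>M\<^esub> v)"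
      if "u \<in> carrier M" for u
      using v that by (auto simp: cochains1_def differential0_def act_add_right)
    have "?B +>\<^bsub>?C\<^esub> z = (\<lambda>u. differential0 L M u \<oplus>\<^bsub>?C\<^esub> z) ` carrier M"
      by (auto simp: a_r_coset_def' coboundaries1_def)
    also have "\<dots> = (\<lambda>u. differential0 L M (u \<oplus>\<^bsub>M\<^esub> v)) ` carrier M"
      using add by (intro image_cong) auto
    also have "\<dots> = differential0 L M ` ((\<lambda>u. u \<oplus>\<^bsub>M\<^esub> v) ` carrier M)"
      by (simp add: image_image)
    also have "(\<lambda>u. u \<oplus>\<^bsub>M\<^esub> v) ` carrier M = carrier M"
    proof (intro subset_antisym subsetI)
      fix w assume "w \<in> carrier M"
      then have "w = (w \<ominus>\<^bsub>M\<^esub> v) \<oplus>\<^bsub>M\<^esub> v"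
        using v(1) by (simp add: M.minus_eq M.M.a_assoc M.M.l_neg)
      then show "w \<in> (\<lambda>u. u \<oplus>\<^bsub>M\<^esub> v) ` carrier M" using \<open>w \<in> carrier M\<close> v(1) by auto
    qed (use v(1) in auto)
    finally show ?thesis by (simp add: coboundaries1_def)
  qed
  have "\<not> cocycles1 L M \<subseteq> ?B"
  proof
    assume "cocycles1 L M \<subseteq> ?B"
    then have "carrier (cohomology1 L M) = {?B}"
      using zero coset by (auto simp: cohomology1_def quotient_space_def A_RCOSETS_def')
    then show False using assms by (simp add: cohomology1_def quotient_space_def)
  qed
  then show ?thesis using that by blast
qed

lemma cocycle_annihilates_second_derived:
  assumes z: "z \<in> cocycles1 L M"
    and D1: "\<And>x v. \<lbrakk>x \<in> derived_series L 1; v \<in> carrier M\<rbrakk> \<Longrightarrow> act M x v = \<zero>\<^bsub>M\<^esub>"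
    and x: "x \<in> derived_series L 2"
  shows "z x = \<zero>\<^bsub>M\<^esub>"
proof -
  interpret z: mod_hom class_ring L M z
    by (intro mod_hom.intro mod_hom_axioms.intro L.module_axioms M.module_axioms cocycle_hom[OF z])
  have "derived_series L (Suc 1) \<subseteq> {x \<in> carrier L. z x = \<zero>\<^bsub>M\<^esub>}"
  proof (rule L.derived_series_Suc_least)
    show "submodule class_ring {x \<in> carrier L. z x = \<zero>\<^bsub>M\<^esub>} L"
      using z.ker_is_submodule by (simp add: z.ker_def)
    fix a b assume ab: "a \<in> derived_series L 1" "b \<in> derived_series L 1"
    note abL = L.derived_series_carrier[OF ab(1)] L.derived_series_carrier[OF ab(2)]
    show "bracket L a b \<in> {x \<in> carrier L. z x = \<zero>\<^bsub>M\<^esub>}"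
      using cocycle_bracket[OF z abL] D1[OF ab(1)] D1[OF ab(2)] cocycle_in[OF z] abL
      by (simp add: L.bracket_closed)
  qed
  then show ?thesis using x by (auto simp: numeral_2_eq_2)
qed

lemma cocycle_equivariant_on_derived:
  assumes z: "z \<in> cocycles1 L M"
    and D1: "\<And>x v. \<lbrakk>x \<in> derived_series L 1; v \<in> carrier M\<rbrakk> \<Longrightarrow> act M x v = \<zero>\<^bsub>M\<^esub>"
    and x: "x \<in> carrier L" and y: "y \<in> derived_series L 1"
  shows "z (bracket L x y) = act M x (z y)"
  using cocycle_bracket[OF z x L.derived_series_carrier[OF y]] D1[OF y] cocycle_in[OF z]
    x L.derived_series_carrier[OF y]
  by (simp add: act_closed)

text \<open>
The element \<open>x\<close> acts as a nonzero operator that commutes with the action of \<open>L\<close>.  Its kernel and its image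
are submodules, so it is bijective on \<open>M\<close>.  With \<open>z(x) = x v\<close>, the identity \<open>0 = z [x, y] = x z(y) - y x v\<close>
becomes \<open>x (z(y) - y v) = 0\<close>, that is, \<open>z(y) = y v\<close>.
\<close>

lemma cocycle_zero_on_derived_is_coboundary:
  assumes z: "z \<in> cocycles1 L M" and irr: "irreducible_lie_module L M"
    and D1: "\<And>x v. \<lbrakk>x \<in> derived_series L 1; v \<in> carrier M\<rbrakk> \<Longrightarrow> act M x v = \<zero>\<^bsub>M\<^esub>"
    and z0: "\<And>x. x \<in> derived_series L 1 \<Longrightarrow> z x = \<zero>\<^bsub>M\<^esub>"
    and nontriv: "x \<in> carrier L" "u \<in> carrier M" "act M x u \<noteq> \<zero>\<^bsub>M\<^esub>"
  shows "z \<in> coboundaries1 L M"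
proof -
  have bracket1: "bracket L a b \<in> derived_series L 1" if "a \<in> carrier L" "b \<in> carrier L" for a b
    using L.bracket_in_derived_series[of a 0 b] that by simp
  have comm: "act M a (act M b v) = act M b (act M a v)"
    if "a \<in> carrier L" "b \<in> carrier L" "v \<in> carrier M" for a b v
    using act_act[OF that] D1[OF bracket1[OF that(1,2)] that(3)] that by (simp add: act_closed)
  note x = nontriv(1)
  note lin = act_linop[OF x]
  have ker: "{v \<in> carrier M. act M x v = \<zero>\<^bsub>M\<^esub>} = {\<zero>\<^bsub>M\<^esub>}"
  proof (rule ccontr)
    assume "{v \<in> carrier M. act M x v = \<zero>\<^bsub>M\<^esub>} \<noteq> {\<zero>\<^bsub>M\<^esub>}"
    then have "{v \<in> carrier M. act M x v = \<zero>\<^bsub>M\<^esub>} = carrier M"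
      using act_closed comm x act_linop[THEN M.linop_zero]
      by (intro irreducibleD[OF irr M.kernel_submodule[OF lin]]) auto
    then show False using nontriv by blast
  qed
  interpret x: mod_hom class_ring M M "act M x"
    by (intro mod_hom.intro mod_hom_axioms.intro M.module_axioms lin)
  have im: "act M x ` carrier M = carrier M"
  proof (rule irreducibleD[OF irr])
    show "submodule class_ring (act M x ` carrier M) M"
      using x.im_is_submodule by (simp add: x.im_def)
    show "act M x ` carrier M \<noteq> {\<zero>\<^bsub>M\<^esub>}" using nontriv by blast
    show "act M a v \<in> act M x ` carrier M" if a: "a \<in> carrier L" and v: "v \<in> act M x ` carrier M" for a v
    proof -
      obtain w where w: "w \<in> carrier M" "v = act M x w" using v by blast
      then have "act M a v = act M x (act M a w)" using comm[OF a x] by simp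
      then show ?thesis using act_closed[OF a w(1)] by blast
    qed
  qed
  have "z x \<in> act M x ` carrier M" using im cocycle_in[OF z x] by simp
  then obtain v where v: "v \<in> carrier M" "z x = act M x v" by blast
  have "z y = act M y v" if y: "y \<in> carrier L" for y
  proof -
    note [simp] = x y v(1) act_closed cocycle_in[OF z]
    have "act M x (z y) \<ominus>\<^bsub>M\<^esub> act M y (z x) = \<zero>\<^bsub>M\<^esub>"
      using cocycle_bracket[OF z x y] z0[OF bracket1[OF x y]] by simp
    then have "act M x (z y) = act M x (act M y v)"
      using M.minus_eq_zero_iff comm[OF x y v(1)] v(2) by simp
    then have "act M x (z y \<ominus>\<^bsub>M\<^esub> act M y v) = \<zero>\<^bsub>M\<^esub>"
      by (simp add: M.linop_minus[OF lin] M.minus_eq_zero_iff)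
    then have "z y \<ominus>\<^bsub>M\<^esub> act M y v \<in> {v \<in> carrier M. act M x v = \<zero>\<^bsub>M\<^esub>}" by simp
    then have "z y \<ominus>\<^bsub>M\<^esub> act M y v = \<zero>\<^bsub>M\<^esub>" unfolding ker by blast
    then show ?thesis by (simp add: M.minus_eq_zero_iff)
  qed
  then have "z = differential0 L M v"
    using cocycle_extensional[OF z] by (intro extensionalityI[of _ "carrier L"]) (auto simp: differential0_def)
  then show ?thesis using v(1) by (simp add: coboundaries1_def)
qed

end

section \<open>Cohomology and composition factors\<close>

theorem theorem4p1:
  fixes \<ss> :: "('k::{alg_closed_field, field_char_0}, 'g) lie_algebra"
  assumes "solvable_lie_algebra \<ss>"
    and "vectorspace.fin_dim class_ring \<ss>"
  shows "(Gamma1 \<ss> :: ('k, 'g, 'v) lie_module set)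
    \<subseteq> composition_factors \<ss> (quotient_module (adjoint_module \<ss>) (derived_series \<ss> 2))"
proof
  fix V :: "('k, 'g, 'v) lie_module"
  assume "V \<in> Gamma1 \<ss>"
  then have irr: "irreducible_lie_module \<ss> V" and fd: "vectorspace.fin_dim class_ring V"
    and H1: "carrier (cohomology1 \<ss> V) \<noteq> {\<zero>\<^bsub>cohomology1 \<ss> V\<^esub>}"
    by (simp_all add: Gamma1_def)
  interpret V: lie_module \<ss> V using irr by (simp add: irreducible_lie_module_def)
  interpret A: lie_module \<ss> "adjoint_module \<ss>" by (rule V.L.adjoint_lie_module)
  let ?D = "derived_series \<ss>"
  note trivial = derived_algebra_annihilates_irreducible[OF assms(1) irr fd]
  obtain z where z: "z \<in> cocycles1 \<ss> V" "z \<notin> coboundaries1 \<ss> V"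
    using V.nonzero_cohomology1E[OF H1] .
  have z2: "z x = \<zero>\<^bsub>V\<^esub>" if "x \<in> ?D 2" for x
    using V.cocycle_annihilates_second_derived[OF z(1) trivial that] .
  have z_hom: "z \<in> LinearCombinations.module_hom class_ring ((adjoint_module \<ss>)\<lparr>carrier := P\<rparr>) V"
    if "P \<subseteq> carrier \<ss>" for P
    using V.cocycle_hom[OF z(1)] that
    by (auto simp: LinearCombinations.module_hom_def subset_iff)
  have factor: "V \<in> composition_factors \<ss> (quotient_module (adjoint_module \<ss>) (?D 2))"
    if P: "lie_submodule \<ss> P (adjoint_module \<ss>)" "?D 2 \<subseteq> P"
      and equivariant: "\<And>x y. \<lbrakk>x \<in> carrier \<ss>; y \<in> P\<rbrakk> \<Longrightarrow> z (bracket \<ss> x y) = act V x (z y)"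
      and u: "u \<in> P" "z u \<noteq> \<zero>\<^bsub>V\<^esub>" for P u
    using lie_submoduleD(3)[OF P(1)] equivariant z2
    by (intro A.irreducible_subquotient_of_quotient[OF V.L.adjoint_fin_dim[OF assms(2)] irr
          V.L.derived_series_lie_submodule P z_hom _ _ u]) auto
  \<comment> \<open>The submodule \<open>P\<close> is the derived algebra if \<open>z\<close> is nonzero there, and the whole algebra
    otherwise.\<close>
  show "V \<in> composition_factors \<ss> (quotient_module (adjoint_module \<ss>) (?D 2))"
  proof (cases "\<exists>u\<in>?D 1. z u \<noteq> \<zero>\<^bsub>V\<^esub>")
    case True
    then obtain u where u: "u \<in> ?D 1" "z u \<noteq> \<zero>\<^bsub>V\<^esub>" by blast
    have "?D 2 \<subseteq> ?D 1" using V.L.derived_series_Suc_subset[of 1] by (simp add: numeral_2_eq_2)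
    then show ?thesis
      using factor[OF V.L.derived_series_lie_submodule _ _ u]
        V.cocycle_equivariant_on_derived[OF z(1) trivial] by blast
  next
    case False
    have act0: "act V x v = \<zero>\<^bsub>V\<^esub>" if "x \<in> carrier \<ss>" "v \<in> carrier V" for x v
      using V.cocycle_zero_on_derived_is_coboundary[OF z(1) irr trivial _ that] False z(2) by blast
    have "\<exists>u\<in>carrier \<ss>. z u \<noteq> \<zero>\<^bsub>V\<^esub>"
    proof (rule ccontr)
      assume "\<not> ?thesis"
      then have "z = differential0 \<ss> V \<zero>\<^bsub>V\<^esub>"
        using V.cocycle_extensional[OF z(1)] act0
        by (intro extensionalityI[of _ "carrier \<ss>"]) (auto simp: differential0_def)
      then show False using z(2) by (simp add: coboundaries1_def)
    qed
    then obtain u where u: "u \<in> carrier \<ss>" "z u \<noteq> \<zero>\<^bsub>V\<^esub>" by blast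
    have "z (bracket \<ss> x y) = act V x (z y)" if "x \<in> carrier \<ss>" "y \<in> carrier \<ss>" for x y
      using V.cocycle_bracket[OF z(1) that] act0 V.cocycle_in[OF z(1)] that by simp
    then show ?thesis
      using factor[of "carrier \<ss>" u] u V.L.derived_series_carrier A.carrier_lie_submodule by auto
  qed
qed

end
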